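(* Assume that $\mu \colon \mathcal{P}^2_o \to \mathbb{R}^2$ is a measurable valuation which is $\mathrm{VL}(2)$-signum-covariant, i.e. $\mu(\phi P) = (\det\phi)\,\phi\,\mu(P)$ for all $P \in \mathcal{P}^2_o$ and all $\phi \in \mathrm{VL}(2)$. Then there exists $k \in \mathbb{R}$ such that $\mu(P) = k\,\rho_{\frac{\pi}{2}}\, m(P^* )$ for all $P \in \mathcal{P}^2_o$.
   Context: $\mathcal{P}^2_o$ denotes the set of convex polygons in $\mathbb{R}^2$ containing the origin in their interiors, with the Hausdorff metric topology; "measurable" refers to Borel $\sigma$-algebras. $\mathrm{VL}(2)$ is the group of linear maps of $\mathbb{R}^2$ with determinant $1$ or $-1$. A map $\mu$ on a family $\mathcal{S}$ of sets is a valuation if $\mu(K \cup L) + \mu(K \cap L) = \mu(K) + \mu(L)$ whenever $K, L, K\cup L, K \cap L \in \mathcal{S}$. The moment vector is $m(P) = \int_P x\,dx$; $P^* = \{y : y^t x \le 1 \ \forall x \in P\}$ is the polar body; $\rho_{\frac{\pi}{2}}$ is the counter-clockwise rotation of $\mathbb{R}^2$ by $\frac{\pi}{2}$. *)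

theory Defs
  imports "HOL-Analysis.Analysis"
begin

type_synonym R2 = "real^2"

definition polygons_o :: "R2 set set" where
  "polygons_o = {P. \<exists>S. finite S \<and> P = convex hull S \<and> 0 \<in> interior P}"

definition hausdorff_dist :: "R2 set \<Rightarrow> R2 set \<Rightarrow> real" where
  "hausdorff_dist K L =
     max (SUP x\<in>K. setdist {x} L) (SUP y\<in>L. setdist {y} K)"

definition hausdorff_open :: "R2 set set \<Rightarrow> bool" where
  "hausdorff_open U \<longleftrightarrow> U \<subseteq> polygons_o \<and>
     (\<forall>P\<in>U. \<exists>e>0. \<forall>Q\<in>polygons_o. hausdorff_dist P Q < e \<longrightarrow> Q \<in> U)"

definition polygons_borel :: "R2 set measure" where
  "polygons_borel = sigma polygons_o {U. hausdorff_open U}"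

definition is_valuation_on :: "'a set set \<Rightarrow> ('a set \<Rightarrow> 'b::ab_group_add) \<Rightarrow> bool" where
  "is_valuation_on S mu \<longleftrightarrow>
     (\<forall>K L. K \<in> S \<and> L \<in> S \<and> K \<union> L \<in> S \<and> K \<inter> L \<in> S \<longrightarrow>
        mu (K \<union> L) + mu (K \<inter> L) = mu K + mu L)"

definition VL2 :: "(real^2^2) set" where
  "VL2 = {A. det A = 1 \<or> det A = -1}"

definition moment :: "R2 set \<Rightarrow> R2" where
  "moment P = integral P (\<lambda>x. x)"

definition polar :: "R2 set \<Rightarrow> R2 set" where
  "polar P = {y. \<forall>x\<in>P. y \<bullet> x \<le> 1}"

definition rot90 :: "R2 \<Rightarrow> R2" where
  "rot90 x = vector [- (x$2), x$1]"

end

theory Submission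
  imports Defs
begin

text \<open>
  Passing to the polar body, \<open>\<nu>(P) = \<rho>\<^sup>-\<^sup>1 \<mu>(P\<^sup>*)\<close> is a valuation with \<open>\<nu>(\<phi> P) = \<phi> \<nu>(P)\<close>, so one has to
  show that \<open>\<nu>\<close> is a multiple of the moment vector.

  Consider a quadrilateral with the origin on the diagonal \<open>[(-a,0), (b,0)]\<close>. For fixed \<open>a, b\<close> the
  valuation property makes \<open>\<nu>\<close> a sum of a function of the upper and one of the lower vertex. How
  the upper summand changes under shears is an additive cocycle, and measurability makes it
  linear with some slope \<open>q(a, b, t)\<close>, where \<open>t\<close> is the height of the upper vertex. The
  remaining symmetries express \<open>\<nu>\<close> of the quadrilateral through \<open>q\<close>. A triangle is a degenerate
  quadrilateral in several ways, which gives a functional equation for \<open>q\<close> with the solutions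
  \<open>q(a, b, t) = C t\<^sup>2 (a + b)\<close> only. Hence \<open>\<nu>\<close> is determined on these quadrilaterals by the
  constant \<open>C\<close>. The moment vector has a nonzero constant, so \<open>\<nu> - k m\<close> vanishes on them
  for some \<open>k\<close>.

  A covariant valuation that vanishes on these quadrilaterals vanishes everywhere: cut off a
  vertex \<open>c\<close> of \<open>P\<close> for which the origin stays in the interior of the hull \<open>A\<close> of the
  other vertices. With the neighbours \<open>x, y\<close> of \<open>c\<close> and a small multiple \<open>w\<close> of \<open>-c\<close> the
  quadrilateral \<open>B = [c, x, w, y]\<close> satisfies \<open>A \<union> B = P\<close> and \<open>A \<inter> B = [x, w, y]\<close>.
\<close>

section \<open>Functional equations\<close>

text \<open>Take a compact \<open>T\<close> inside \<open>A\<close> and an open \<open>U\<close>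
  around \<open>T\<close> such that \<open>U - T\<close> has smaller measure than \<open>T\<close>.
  A short translate of \<open>T\<close> stays in \<open>U\<close>; if no point of \<open>A\<close>
  were moved into \<open>A\<close>, the translate would fit into \<open>U - T\<close>, which is too
  small.\<close>

lemma steinhaus_difference:
  fixes A :: "real set"
  assumes A: "A \<in> sets lebesgue" "bounded A" and pos: "emeasure lebesgue A > 0"
  obtains d where "d > 0" "\<And>t. \<bar>t\<bar> < d \<Longrightarrow> \<exists>x\<in>A. x + t \<in> A"
proof -
  have lmA: "A \<in> lmeasurable"
    using A by (simp add: bounded_set_imp_lmeasurable)
  then have mA: "measure lebesgue A > 0"
    using pos by (simp add: emeasure_eq_measure2 ennreal_less_zero_iff)
  obtain T where T: "closed T" "T \<subseteq> A" "A - T \<in> lmeasurable"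
      "emeasure lebesgue (A - T) < ennreal (measure lebesgue A)"
    using sets_lebesgue_inner_closed[OF A(1) mA] by blast
  have cT: "compact T"
    using T A(2) bounded_subset compact_eq_bounded_closed by blast
  then have lmT: "T \<in> lmeasurable"
    by (rule lmeasurable_compact)
  have "measure lebesgue (A - T) < measure lebesgue A"
    using T(3,4) by (simp add: emeasure_eq_measure2 mA ennreal_less_iff)
  moreover have "measure lebesgue (A - T) = measure lebesgue A - measure lebesgue T"
    using measurable_measure_Diff[of A lebesgue T] lmA lmT T(2) by (simp add: fmeasurableD)
  ultimately have mT: "measure lebesgue T > 0" by simp
  obtain U where U: "open U" "T \<subseteq> U" "U - T \<in> lmeasurable"
      "emeasure lebesgue (U - T) < ennreal (measure lebesgue T)"
    using sets_lebesgue_outer_open[OF fmeasurableD[OF lmT] mT] by blast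
  have mU: "measure lebesgue (U - T) < measure lebesgue T"
    using U(3,4) by (simp add: emeasure_eq_measure2 mT ennreal_less_iff)
  obtain d where d: "d > 0" "\<And>x y. x \<in> T \<Longrightarrow> y \<in> - U \<Longrightarrow> d \<le> dist x y"
  proof -
    have "closed (- U)" "T \<inter> - U = {}" using U(1,2) by auto
    from separate_compact_closed[OF cT this] show thesis using that by blast
  qed
  show thesis
  proof
    show "d > 0" by fact
    fix t :: real assume t: "\<bar>t\<bar> < d"
    show "\<exists>x\<in>A. x + t \<in> A"
    proof (rule ccontr)
      assume none: "\<not> ?thesis"
      have "(+) t ` T \<subseteq> U - T"
      proof (rule subsetI)
        fix y assume "y \<in> (+) t ` T"
        then obtain x where x: "x \<in> T" "y = t + x" by (rule imageE) (rule that)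
        have "dist x y < d" using x t by (simp add: dist_real_def)
        then have "y \<in> U" using d(2)[OF x(1), of y] by force
        moreover have "y \<notin> T" using none x T(2) add.commute[of t x] by auto
        ultimately show "y \<in> U - T" by simp
      qed
      moreover have "(+) t ` T \<in> lmeasurable"
        using lmT by (simp add: measurable_translation)
      ultimately have "measure lebesgue ((+) t ` T) \<le> measure lebesgue (U - T)"
        using U(3) by (intro measure_mono_fmeasurable) (auto intro: fmeasurableD)
      then show False
        using mU by (simp add: measure_translation)
    qed
  qed
qed

text \<open>Differences of points of \<open>A\<close> fill a neighbourhood of 0, so \<open>f\<close>
  is bounded there. Subtracting a linear function makes it periodic, hence bounded everywhere, and a
  bounded additive function is 0.\<close>

lemma additive_bounded_imp_linear:
  fixes f :: "real \<Rightarrow> real"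
  assumes add: "\<And>x y. f (x + y) = f x + f y"
    and A: "A \<in> sets lebesgue" "bounded A" "emeasure lebesgue A > 0"
    and bnd: "bounded (f ` A)"
  shows "f c = c * f 1"
proof -
  obtain d where d: "d > 0" "\<And>t. \<bar>t\<bar> < d \<Longrightarrow> \<exists>x\<in>A. x + t \<in> A"
    using steinhaus_difference[OF A] by blast
  obtain M where M: "\<And>x. x \<in> A \<Longrightarrow> \<bar>f x\<bar> \<le> M"
    using bnd by (auto simp: bounded_iff)
  have near0: "\<bar>f t\<bar> \<le> 2 * M" if t: "\<bar>t\<bar> < d" for t
  proof -
    obtain x where "x \<in> A" "x + t \<in> A" using d(2)[OF t] by blast
    then show ?thesis using add[of x t] M[of x] M[of "x + t"] by auto
  qed
  define p where "p = d / 2"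
  have p: "p > 0" "p < d" using d(1) by (auto simp: p_def)
  \<comment> \<open>\<open>h\<close> is additive and vanishes at \<open>p\<close>, so
    \<open>p\<close> is a period; over one period \<open>h\<close> is bounded because
    \<open>p < d\<close>.\<close>
  define h where "h x = f x - x / p * f p" for x
  have h_add: "h (x + y) = h x + h y" for x y
    by (simp add: h_def add add_divide_distrib algebra_simps)
  have h0: "h 0 = 0" using h_add[of 0 0] by simp
  have hp: "h p = 0" using p by (simp add: h_def)
  have h_nat: "h (real n * x) = real n * h x" for n x
    by (induction n) (auto simp: h0 h_add algebra_simps)
  have h_neg: "h (- x) = - h x" for x
    using h_add[of x "-x"] h0 by simp
  have h_int: "h (of_int k * p) = 0" for k :: int
  proof (cases "k \<ge> 0")
    case True
    then show ?thesis using h_nat[of "nat k" p] hp by simp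
  next
    case False
    then have "of_int k * p = - (real (nat (-k)) * p)" by simp
    then show ?thesis using h_nat[of "nat (-k)" p] hp h_neg[of "real (nat (-k)) * p"] by simp
  qed
  define B where "B = 2 * M + \<bar>f p\<bar>"
  have h_bnd: "\<bar>h x\<bar> \<le> B" for x
  proof -
    define y where "y = x - of_int \<lfloor>x / p\<rfloor> * p"
    have y: "0 \<le> y" "y < p"
    proof -
      have "of_int \<lfloor>x / p\<rfloor> * p \<le> x / p * p"
        using p by (intro mult_right_mono of_int_floor_le) auto
      then show "0 \<le> y" using p by (simp add: y_def)
      have "x / p * p < (of_int \<lfloor>x / p\<rfloor> + 1) * p"
        using p by (intro mult_strict_right_mono) linarith+
      then show "y < p" using p by (simp add: y_def algebra_simps)
    qed
    have "h x = h y"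
      using h_add[of y "of_int \<lfloor>x / p\<rfloor> * p"] h_int by (simp add: y_def)
    moreover have "\<bar>y / p * f p\<bar> \<le> \<bar>f p\<bar>"
      unfolding abs_mult using y p by (intro mult_left_le_one_le) auto
    moreover have "\<bar>f y\<bar> \<le> 2 * M" using near0 y p by auto
    ultimately show ?thesis unfolding h_def B_def by linarith
  qed
  have h_zero: "h x = 0" for x
  proof (rule ccontr)
    assume "h x \<noteq> 0"
    then obtain n where "B < real n * \<bar>h x\<bar>"
      using reals_Archimedean3[of "\<bar>h x\<bar>"] by auto
    moreover have "real n * \<bar>h x\<bar> \<le> B"
      using h_bnd[of "real n * x"] by (simp add: h_nat abs_mult)
    ultimately show False by simp
  qed
  have eq: "f x = x / p * f p" for x
    using h_zero[of x] unfolding h_def by linarith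
  have "f 1 = f p / p" using eq[of 1] by simp
  then show ?thesis by (simp add: eq[of c])
qed

section \<open>The functional equation for the kernel \<open>q\<close>\<close>

text \<open>\<open>sep\<close> and \<open>hom\<close> reduce \<open>q\<close> to a function
  \<open>g\<close> of one variable and a remainder \<open>h\<close>. The relation \<open>tri\<close>
  at \<open>s = t\<close> leaves a ratio free to vary, which forces \<open>z * g z\<close> to be
  \<open>C * z\<^sup>2 + E\<close>; afterwards \<open>E\<close> and \<open>h\<close> turn out to be
  0.\<close>

lemma kernel_functional_equation:
  fixes q :: "real \<Rightarrow> real \<Rightarrow> real \<Rightarrow> real"
  assumes sym: "\<And>a b t. a > 0 \<Longrightarrow> b > 0 \<Longrightarrow> t > 0 \<Longrightarrow> q a b t = q b a t"
    and hom: "\<And>l a b t. l > 0 \<Longrightarrow> a > 0 \<Longrightarrow> b > 0 \<Longrightarrow> t > 0 \<Longrightarrow>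
        q (l * a) (l * b) (t / l) = q a b t / l"
    and sep: "\<And>a b s t. a > 0 \<Longrightarrow> b > 0 \<Longrightarrow> s > 0 \<Longrightarrow> t > 0 \<Longrightarrow>
        2 * (q s t b - q s t a) = (q t t b - q t t a) + (q s s b - q s s a)"
    and tri: "\<And>b s t. b > 0 \<Longrightarrow> s > 0 \<Longrightarrow> t > 0 \<Longrightarrow>
        q 1 (b * (s + t) / t) (s / (b * (s + t) / t + 1)) - q 1 (b * (s + t) / t) t
          + s / (b * (s + t) / t) * q t (s / (b * (s + t) / t + 1)) (b * (s + t) / t)
        = q 1 b s - q 1 b t"
  obtains C where "\<And>a b t. a > 0 \<Longrightarrow> b > 0 \<Longrightarrow> t > 0 \<Longrightarrow> q a b t = C * t\<^sup>2 * (a + b)"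
proof -
  define g where "g z = q 1 1 z / (2 * z)" for z
  define h where "h a b = q a b 1 - (g a + g b)" for a b
  have diag: "q a a t = 2 * t * g (a * t)" if "a > 0" "t > 0" for a t
  proof -
    have "q a a t = q (a * 1) (a * 1) ((a * t) / a)" using that by simp
    also have "\<dots> = q 1 1 (a * t) / a" using that by (subst hom) auto
    finally show ?thesis using that by (simp add: g_def)
  qed
  have q_eq: "q a b t = t * (g (a * t) + g (b * t)) + h a b" if "a > 0" "b > 0" "t > 0" for a b t
    using sep[of 1 t a b] that by (simp add: h_def diag algebra_simps)
  have h_sym: "h a b = h b a" if "a > 0" "b > 0" for a b
    using sym[of a b 1] that by (simp add: h_def)
  have h_diag: "h a a = 0" if "a > 0" for a
    using diag[of a 1] that by (simp add: h_def)
  have h_hom: "h (l * a) (l * b) = h a b / l" if "l > 0" "a > 0" "b > 0" for l a b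
    using hom[of l a b 1] that q_eq[of "l * a" "l * b" "1 / l"] q_eq[of a b 1]
    by (simp add: field_simps)
  define w where "w z = z * g z" for z
  \<comment> \<open>At equal heights the right side of \<open>tri\<close> is 0, and
    \<open>b = (n - 1) / 2\<close> turns \<open>b * (s + t) / t\<close> into
    \<open>n - 1\<close>.\<close>
  have iso: "w s = w (s / n) + s / n * g ((n - 1) * s / n) * (1 + n) + s / (n - 1) * h s (s / n)"
    if s: "s > 0" and n: "n > 1" for s n
  proof -
    define b where "b = (n - 1) / 2"
    have b: "b > 0" "b * (s + s) / s = n - 1" "s / (b * (s + s) / s + 1) = s / n"
      using s n by (auto simp: b_def field_simps)
    have eq: "q 1 (n - 1) (s / n) - q 1 (n - 1) s + s / (n - 1) * q s (s / n) (n - 1) = 0"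
      using tri[OF b(1) s s] unfolding b by simp
    have 1: "q 1 (n - 1) (s / n) = s / n * (g (s / n) + g ((n - 1) * s / n)) + h 1 (n - 1)"
      using q_eq[of 1 "n - 1" "s / n"] s n by simp
    have 2: "q 1 (n - 1) s = s * (g s + g ((n - 1) * s)) + h 1 (n - 1)"
      using q_eq[of 1 "n - 1" s] s n by simp
    have "q s (s / n) (n - 1) = (n - 1) * (g ((n - 1) * s) + g ((n - 1) * s / n)) + h s (s / n)"
      using q_eq[of s "s / n" "n - 1"] s n by (simp add: mult.commute)
    then have 3: "s / (n - 1) * q s (s / n) (n - 1)
        = s * (g ((n - 1) * s) + g ((n - 1) * s / n)) + s / (n - 1) * h s (s / n)"
      using n by (simp add: distrib_left)
    have "s * g s = s / n * (g (s / n) + g ((n - 1) * s / n)) + s * g ((n - 1) * s / n)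
        + s / (n - 1) * h s (s / n)"
      using eq unfolding 1 2 3 by (simp add: algebra_simps)
    also have "\<dots> = s / n * g (s / n) + s / n * g ((n - 1) * s / n) * (1 + n) + s / (n - 1) * h s (s / n)"
      using n by (simp add: field_simps)
    finally show ?thesis by (simp add: w_def)
  qed
  define H where "H c = h 1 c" for c
  have iso': "w z = w (c * z) + (1 + c) / (1 - c) * w ((1 - c) * z) + c / (1 - c) * H c"
    if z: "z > 0" and c: "0 < c" "c < 1" for z c
  proof -
    have n: "1 / c > 1" using c by simp
    have "h z (c * z) = h (z * 1) (z * c)" by (simp add: mult.commute)
    also have "\<dots> = H c / z" using h_hom[of z 1 c] z c by (simp add: H_def)
    finally have h': "h z (c * z) = H c / z" by simp
    have arg: "(1 / c - 1) * z / (1 / c) = (1 - c) * z" "z / (1 / c) = c * z"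
      using c by (auto simp: field_simps)
    have t1: "c * z * g ((1 - c) * z) * (1 + 1 / c) = (1 + c) / (1 - c) * w ((1 - c) * z)"
      using c z by (simp add: w_def field_simps)
    have t2: "z / (1 / c - 1) * (H c / z) = c / (1 - c) * H c"
      using c z by (simp add: field_simps)
    show ?thesis
      using iso[OF z n] unfolding arg t1 unfolding h' t2 by simp
  qed
  define W where "W z = w z / z\<^sup>2" for z
  define K where "K c = c * (1 - c) * ((1 - c) / c * H (1 - c) - c / (1 - c) * H c) / 2 / (c\<^sup>2 * (1 - c)\<^sup>2)" for c
  \<comment> \<open>\<open>iso'\<close> for \<open>c\<close> and for \<open>1 - c\<close> expands
    the same \<open>w z\<close>; equating both expansions leaves only the values of \<open>w\<close>
    at \<open>c * z\<close> and \<open>(1 - c) * z\<close>.\<close>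
  have W_diff: "W ((1 - c) * z) - W (c * z) = K c / z\<^sup>2"
    if z: "z > 0" and c: "0 < c" "c < 1" for z c
  proof -
    define A B h1 h2 where "A = w (c * z)" and "B = w ((1 - c) * z)"
      and "h1 = c / (1 - c) * H c" and "h2 = (1 - c) / c * H (1 - c)"
    have e1: "w z = A + (1 + c) / (1 - c) * B + h1"
      using iso'[OF z c] by (simp add: A_def B_def h1_def)
    have e2: "w z = B + (2 - c) / c * A + h2"
      using iso'[OF z, of "1 - c"] c by (simp add: A_def B_def h2_def)
    have "A + (1 + c) / (1 - c) * B + h1 = B + (2 - c) / c * A + h2" using e1 e2 by simp
    then have "c\<^sup>2 * B - (1 - c)\<^sup>2 * A = c * (1 - c) * (h2 - h1) / 2"
      using c by (simp add: field_simps power2_eq_square)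
    moreover have "W ((1 - c) * z) - W (c * z) = (c\<^sup>2 * B - (1 - c)\<^sup>2 * A) / (c\<^sup>2 * (1 - c)\<^sup>2) / z\<^sup>2"
      using c z by (simp add: W_def A_def B_def divide_simps power_mult_distrib)
    ultimately show ?thesis by (simp only: K_def h1_def h2_def)
  qed
  \<comment> \<open>Any two positive numbers have the form \<open>(1 - c) * z\<close> and
    \<open>c * z\<close> with \<open>z = x + y\<close>, so differences of \<open>W\<close> are
    homogeneous of degree -2.\<close>
  have W_scale: "W (l * x) - W (l * y) = (W x - W y) / l\<^sup>2" if "l > 0" "x > 0" "y > 0" for l x y
  proof -
    define c where "c = y / (x + y)"
    have c: "0 < c" "c < 1" using that by (auto simp: c_def)
    have xy: "(1 - c) * (x + y) = x" "c * (x + y) = y" using that by (auto simp: c_def field_simps)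
    have lxy: "(1 - c) * (l * (x + y)) = l * x" "c * (l * (x + y)) = l * y"
      using xy by (metis mult.left_commute)+
    have "W x - W y = K c / (x + y)\<^sup>2"
      using W_diff[of "x + y" c] that c xy by simp
    moreover have "W (l * x) - W (l * y) = K c / (l * (x + y))\<^sup>2"
      using W_diff[of "l * (x + y)" c] that c lxy by simp
    ultimately show ?thesis by (simp add: power_mult_distrib)
  qed
  \<comment> \<open>\<open>C\<close> and \<open>E\<close> are the coefficients for which
    \<open>C + E / z\<^sup>2\<close> agrees with \<open>W\<close> at 1 and 2.\<close>
  define E where "E = (W 2 - W 1) / (1 / 2\<^sup>2 - 1)"
  define C where "C = W 1 - E"
  have w_eq: "w z = C * z\<^sup>2 + E" if z: "z > 0" for z
  proof -
    \<comment> \<open>\<open>W (2 * z)\<close> is reached in two ways: by scaling the pair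
      \<open>z, 1\<close> by 2 and by scaling the pair \<open>2, 1\<close> by
      \<open>z\<close>.\<close>
    have "W (2 * z) - W 2 = (W z - W 1) / 4" using W_scale[of 2 z 1] z by simp
    moreover have "W (2 * z) - W z = (W 2 - W 1) / z\<^sup>2"
      using W_scale[of z 2 1] z by (simp add: mult.commute)
    ultimately have "(W z - W 1) / 4 - (W z - W 1) = (W 2 - W 1) / z\<^sup>2 - (W 2 - W 1)"
      by linarith
    moreover have "W 2 - W 1 = - (3 / 4) * E" by (simp add: E_def)
    ultimately have "(W z - W 1) / 4 - (W z - W 1) = - (3 / 4) * (E / z\<^sup>2) + 3 / 4 * E" by simp
    moreover define r where "r = E / z\<^sup>2"
    ultimately have "W z = W 1 - E + r" unfolding r_def[symmetric] by (simp add: field_simps)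
    then have "W z = C + E / z\<^sup>2" by (simp add: C_def r_def)
    then show ?thesis using z by (simp add: W_def field_simps)
  qed
  have g_eq: "g z = C * z + E / z" if "z > 0" for z
    using w_eq[OF that] that by (simp add: w_def field_simps power2_eq_square)
  \<comment> \<open>In this instance the unknown terms \<open>h 1 2\<close> and
    \<open>h 1 (1/2)\<close> cancel and \<open>h 1 1\<close> is 0; the terms in \<open>C\<close>
    balance, and \<open>3 * E = 0\<close> is left.\<close>
  have "E = 0"
    using tri[of "1/2" 3 1] by (simp add: q_eq h_diag g_eq)
  \<comment> \<open>For \<open>w z = C * z\<^sup>2\<close> the terms of \<open>iso'\<close> in
    \<open>w\<close> balance by themselves, so the term in \<open>H c\<close> must vanish.\<close>
  have h_small: "h 1 c = 0" if c: "0 < c" "c < 1" for c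
  proof -
    have "C = C * c\<^sup>2 + (1 + c) / (1 - c) * (C * (1 - c)\<^sup>2) + c / (1 - c) * H c"
      using iso'[of 1 c] c by (simp add: w_eq \<open>E = 0\<close>)
    moreover have "(1 + c) / (1 - c) * (C * (1 - c)\<^sup>2) = C - C * c\<^sup>2"
      using c by (simp add: field_simps power2_eq_square)
    ultimately have "c / (1 - c) * H c = 0" by simp
    then show ?thesis using c by (simp add: H_def)
  qed
  have h_zero: "h a b = 0" if ab: "a > 0" "b > 0" for a b
  proof -
    have lt: "h a b = 0" if "0 < b" "b < a" for a b
      using h_hom[of a 1 "b / a"] h_small[of "b / a"] that by simp
    show ?thesis
      using lt[of b a] lt[of a b] h_diag[of a] h_sym[of a b] ab
      by (cases a b rule: linorder_cases) auto
  qed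
  show thesis
  proof
    fix a b t :: real assume "a > 0" "b > 0" "t > 0"
    then show "q a b t = C * t\<^sup>2 * (a + b)"
      by (simp add: q_eq g_eq h_zero \<open>E = 0\<close> algebra_simps power2_eq_square)
  qed
qed

section \<open>Quadrilaterals with a horizontal diagonal through the origin\<close>

text \<open>A convex set with empty interior lies in a hyperplane; otherwise an origin outside the
  interior has a supporting hyperplane. Either normal violates the condition on \<open>w\<close>. In
  this form membership can be tested on generating points.\<close>

lemma zero_in_interior_iff:
  fixes S :: "'a::euclidean_space set"
  assumes S: "convex S"
  shows "0 \<in> interior S \<longleftrightarrow> (\<forall>w. w \<noteq> 0 \<longrightarrow> (\<exists>y\<in>S. w \<bullet> y < 0))"
proof
  assume "0 \<in> interior S"
  then obtain e where e: "e > 0" "cball 0 e \<subseteq> S" by (meson mem_interior_cball)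
  show "\<forall>w. w \<noteq> 0 \<longrightarrow> (\<exists>y\<in>S. w \<bullet> y < 0)"
  proof (intro allI impI)
    fix w :: 'a assume "w \<noteq> 0"
    then have "- (e / norm w) *\<^sub>R w \<in> S" "w \<bullet> (- (e / norm w) *\<^sub>R w) < 0"
      using e by (auto simp: subset_iff)
    then show "\<exists>y\<in>S. w \<bullet> y < 0" by blast
  qed
next
  assume sep: "\<forall>w. w \<noteq> 0 \<longrightarrow> (\<exists>y\<in>S. w \<bullet> y < 0)"
  have "0 \<in> S" using separating_hyperplane_set_0[OF S] sep by force
  have ne: "interior S \<noteq> {}"
  proof
    assume "interior S = {}"
    then obtain a b where "a \<noteq> 0" "S \<subseteq> {x. a \<bullet> x = b}"
      using empty_interior_subset_hyperplane[OF S] by metis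
    moreover from this have "b = 0" using \<open>0 \<in> S\<close> by auto
    ultimately show False using sep by fastforce
  qed
  show "0 \<in> interior S"
  proof (rule ccontr)
    assume "0 \<notin> interior S"
    then have "0 \<notin> rel_interior S" using rel_interior_nonempty_interior[OF ne] by simp
    moreover have "0 \<in> closure S" using \<open>0 \<in> S\<close> closure_subset by auto
    ultimately obtain a where a: "a \<noteq> 0" "\<And>y. y \<in> closure S \<Longrightarrow> a \<bullet> 0 \<le> a \<bullet> y"
      using supporting_hyperplane_relative_frontier[OF S] by metis
    obtain y where "y \<in> S" "a \<bullet> y < 0" using sep a(1) by blast
    then show False using a(2)[of y] closure_subset[of S] by auto
  qed
qed

lemma zero_in_interior_hull_iff:
  fixes T :: "'a::euclidean_space set"
  shows "0 \<in> interior (convex hull T) \<longleftrightarrow> (\<forall>w. w \<noteq> 0 \<longrightarrow> (\<exists>y\<in>T. w \<bullet> y < 0))"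
proof -
  have "(\<exists>y\<in>convex hull T. w \<bullet> y < 0) \<longleftrightarrow> (\<exists>y\<in>T. w \<bullet> y < 0)" for w
  proof
    assume *: "\<exists>y\<in>convex hull T. w \<bullet> y < 0"
    show "\<exists>y\<in>T. w \<bullet> y < 0"
    proof (rule ccontr)
      assume "\<not> ?thesis"
      then have "convex hull T \<subseteq> {y. w \<bullet> y \<ge> 0}"
        by (intro hull_minimal convex_halfspace_ge) (auto simp: not_less)
      then show False using * by force
    qed
  qed (use hull_inc in fast)
  then show ?thesis by (simp add: zero_in_interior_iff)
qed

lemma hull_in_polygons_o:
  "finite T \<Longrightarrow> 0 \<in> interior (convex hull T) \<Longrightarrow> convex hull T \<in> polygons_o"
  by (auto simp: polygons_o_def)

section \<open>Coordinates and matrices in the plane\<close>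

definition pt :: "real \<Rightarrow> real \<Rightarrow> R2" where "pt x y = vector [x, y]"

lemma pt_nth [simp]: "pt x y $ 1 = x" "pt x y $ 2 = y"
  by (auto simp: pt_def)

lemma R2_eq_iff: "(x::R2) = y \<longleftrightarrow> x $ 1 = y $ 1 \<and> x $ 2 = y $ 2"
  by (simp add: vec_eq_iff forall_2)

lemma inner_R2: "(x::R2) \<bullet> y = x $ 1 * y $ 1 + x $ 2 * y $ 2"
  by (simp add: inner_vec_def sum_2)

definition mat2 :: "real \<Rightarrow> real \<Rightarrow> real \<Rightarrow> real \<Rightarrow> real^2^2" where
  "mat2 a b c d = vector [vector [a, b], vector [c, d]]"

lemma mat2_nth [simp]:
  "mat2 a b c d $ 1 $ 1 = a" "mat2 a b c d $ 1 $ 2 = b"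
  "mat2 a b c d $ 2 $ 1 = c" "mat2 a b c d $ 2 $ 2 = d"
  by (auto simp: mat2_def)

lemma det_mat2 [simp]: "det (mat2 a b c d) = a * d - b * c"
  by (simp add: det_2)

lemma mult_R2_nth: "((A::real^2^2) *v x) $ i = A $ i $ 1 * x $ 1 + A $ i $ 2 * x $ 2"
  by (simp add: matrix_vector_mult_def sum_2)

lemma mat2_mult_pt [simp]: "mat2 a b c d *v pt x y = pt (a * x + b * y) (c * x + d * y)"
  by (simp add: R2_eq_iff mult_R2_nth)

lemma matrix_image_hull: "(*v) (A::real^2^2) ` (convex hull S) = convex hull ((*v) A ` S)"
  by (rule convex_hull_linear_image) simp

lemma mult_in_polygons_o:
  assumes A: "A \<in> VL2" and P: "P \<in> polygons_o"
  shows "(*v) A ` P \<in> polygons_o"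
proof -
  obtain S where S: "finite S" "P = convex hull S" "0 \<in> interior P"
    using P by (auto simp: polygons_o_def)
  have inv: "invertible A" using A by (auto simp: VL2_def invertible_det_nz)
  have "0 \<in> interior (convex hull ((*v) A ` S))"
    unfolding zero_in_interior_hull_iff
  proof (intro allI impI)
    fix w :: R2 assume "w \<noteq> 0"
    have "transpose A *v w \<noteq> 0"
      using \<open>w \<noteq> 0\<close> inv inj_matrix_vector_mult[of "transpose A"]
      by (metis det_transpose invertible_det_nz injD matrix_vector_mult_0_right)
    then obtain y where "y \<in> S" "(transpose A *v w) \<bullet> y < 0"
      using S zero_in_interior_hull_iff[of S] by auto
    then have "w \<bullet> (A *v y) < 0" by (simp add: dot_lmul_matrix)
    then show "\<exists>y\<in>(*v) A ` S. w \<bullet> y < 0" using \<open>y \<in> S\<close> by blast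
  qed
  then show ?thesis
    using S by (simp add: matrix_image_hull hull_in_polygons_o)
qed

section \<open>Quadrilaterals over a horizontal diagonal\<close>

text \<open>Upper and lower vertex have the abscissae \<open>c * t\<close> and \<open>d * s\<close>,
  so that a horizontal shear by \<open>e\<close> acts simply as \<open>c + e\<close> and
  \<open>d - e\<close>, whatever the heights.\<close>

definition quad :: "real \<Rightarrow> real \<Rightarrow> real \<Rightarrow> real \<Rightarrow> real \<Rightarrow> real \<Rightarrow> R2 set" where
  "quad a b c t d s = convex hull {pt b 0, pt (- a) 0, pt (c * t) t, pt (d * s) (- s)}"

lemma quad_in_polygons_o:
  assumes "a > 0" "b > 0" "t > 0" "s > 0"
  shows "quad a b c t d s \<in> polygons_o"
  unfolding quad_def
proof (rule hull_in_polygons_o)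
  show "0 \<in> interior (convex hull {pt b 0, pt (- a) 0, pt (c * t) t, pt (d * s) (- s)})"
    unfolding zero_in_interior_hull_iff
  proof (intro allI impI)
    fix w :: R2 assume "w \<noteq> 0"
    then consider "w $ 1 < 0" | "w $ 1 > 0" | "w $ 1 = 0" "w $ 2 < 0" | "w $ 1 = 0" "w $ 2 > 0"
      unfolding R2_eq_iff by (metis linorder_neqE_linordered_idom zero_index)
    then show "\<exists>y\<in>{pt b 0, pt (- a) 0, pt (c * t) t, pt (d * s) (- s)}. w \<bullet> y < 0"
      using assms by cases (auto simp: inner_R2 mult_less_0_iff)
  qed
qed simp

lemma convex_R2_halfplanes:
  "convex {z::R2. z $ 1 \<le> k + z $ 2 * m}" "convex {z::R2. k + z $ 2 * m \<le> z $ 1}"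
proof -
  have "{z::R2. z $ 1 \<le> k + z $ 2 * m} = {z. pt 1 (- m) \<bullet> z \<le> k}"
    "{z::R2. k + z $ 2 * m \<le> z $ 1} = {z. pt 1 (- m) \<bullet> z \<ge> k}"
    by (auto simp: inner_R2 mult.commute)
  then show "convex {z::R2. z $ 1 \<le> k + z $ 2 * m}" "convex {z::R2. k + z $ 2 * m \<le> z $ 1}"
    by (simp_all add: convex_halfspace_le convex_halfspace_ge)
qed

lemma convex_hull_triangleI:
  assumes "x \<in> convex hull S" "y \<in> convex hull S" "z \<in> convex hull S"
    and "u \<ge> 0" "v \<ge> 0" "w \<ge> 0" "u + v + w = (1::real)"
  shows "u *\<^sub>R x + v *\<^sub>R y + w *\<^sub>R z \<in> convex hull S"
proof -
  have "u *\<^sub>R x + v *\<^sub>R y + w *\<^sub>R z \<in> convex hull {x, y, z}"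
    unfolding convex_hull_3 using assms by blast
  also have "\<dots> \<subseteq> convex hull S"
    using assms by (intro hull_minimal) auto
  finally show ?thesis .
qed

text \<open>These are the weights at \<open>b\<close> and \<open>- a\<close> with total
  \<open>r\<close> and weighted sum \<open>x\<close>; they supply barycentric coordinates in the
  triangles over the diagonal.\<close>

lemma segment_barycentric:
  fixes a b r x :: real
  assumes "a > 0" "b > 0"
  shows "(a * r + x) / (a + b) + (b * r - x) / (a + b) = r"
    "(a * r + x) / (a + b) * b - (b * r - x) / (a + b) * a = x"
proof -
  have "a + b \<noteq> 0" using assms by simp
  have "(a * r + x) + (b * r - x) = r * (a + b)" by (simp add: algebra_simps)
  then show "(a * r + x) / (a + b) + (b * r - x) / (a + b) = r"
    using \<open>a + b \<noteq> 0\<close> by (simp add: add_divide_distrib[symmetric])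
  have "(a * r + x) * b - (b * r - x) * a = x * (a + b)" by (simp add: algebra_simps)
  then show "(a * r + x) / (a + b) * b - (b * r - x) / (a + b) * a = x"
    using \<open>a + b \<noteq> 0\<close> by (simp add: diff_divide_distrib[symmetric])
qed

text \<open>The parameters of \<^const>\<open>quad\<close> describe four points in weakly convex position.\<close>
definition quad_dom :: "real \<Rightarrow> real \<Rightarrow> real \<Rightarrow> real \<Rightarrow> real \<Rightarrow> real \<Rightarrow> bool" where
  "quad_dom a b c t d s \<longleftrightarrow> a > 0 \<and> b > 0 \<and> t > 0 \<and> s > 0 \<and>
     c - b / t \<le> b / s - d \<and> - d - a / s \<le> c + a / t"

text \<open>The diagonal cuts the quadrilateral into two triangles, each bounded by two further
  edges. The inequalities of \<open>quad_dom\<close> order the edge slopes so that each edge line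
  also bounds the opposite half; this makes the right side convex.\<close>

lemma quad_eq:
  assumes "quad_dom a b c t d s"
  shows "quad a b c t d s = {z.
     (z $ 2 \<ge> 0 \<longrightarrow> - a + z $ 2 * (c + a / t) \<le> z $ 1 \<and> z $ 1 \<le> b + z $ 2 * (c - b / t)) \<and>
     (z $ 2 \<le> 0 \<longrightarrow> - a + z $ 2 * (- d - a / s) \<le> z $ 1 \<and> z $ 1 \<le> b + z $ 2 * (b / s - d))}"
    (is "_ = ?R")
proof -
  have pos: "a > 0" "b > 0" "t > 0" "s > 0"
    and D: "c - b / t \<le> b / s - d" "- d - a / s \<le> c + a / t"
    using assms by (auto simp: quad_dom_def)
  let ?H = "{z::R2. z $ 1 \<le> b + z $ 2 * (c - b / t)} \<inter> {z. z $ 1 \<le> b + z $ 2 * (b / s - d)}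
      \<inter> {z. - a + z $ 2 * (c + a / t) \<le> z $ 1} \<inter> {z. - a + z $ 2 * (- d - a / s) \<le> z $ 1}"
  have RH: "?R = ?H"
  proof -
    have aux: "((y \<ge> 0 \<longrightarrow> - a + C \<le> x \<and> x \<le> b + A) \<and> (y \<le> 0 \<longrightarrow> - a + D \<le> x \<and> x \<le> b + B)) \<longleftrightarrow>
        x \<le> b + A \<and> x \<le> b + B \<and> - a + C \<le> x \<and> - a + D \<le> x"
      if "y \<ge> 0 \<Longrightarrow> A \<le> B \<and> D \<le> C" "y \<le> 0 \<Longrightarrow> B \<le> A \<and> C \<le> D" for x y A B C D :: real
      using that by linarith
    have "z \<in> ?R \<longleftrightarrow> z \<in> ?H" for z
      unfolding mem_Collect_eq Int_iff conj_assoc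
      by (rule aux; intro conjI mult_left_mono mult_left_mono_neg D)
    then show ?thesis by blast
  qed
  have "convex ?H"
    by (intro convex_Int convex_R2_halfplanes)
  then have conv: "convex ?R" by (simp only: RH)
  have "{pt b 0, pt (- a) 0, pt (c * t) t, pt (d * s) (- s)} \<subseteq> ?R"
    using pos by (auto simp: algebra_simps)
  then have "quad a b c t d s \<subseteq> ?R"
    unfolding quad_def using conv by (rule hull_minimal)
  moreover have "z \<in> quad a b c t d s" if z: "z \<in> ?R" for z
  proof (cases "z $ 2 \<ge> 0")
    case True
    \<comment> \<open>The height of \<open>z\<close> fixes the weight \<open>n\<close> of the upper
      vertex; the rest \<open>1 - n\<close> is distributed over the diagonal so as to match the
      abscissa.\<close>
    define n where "n = z $ 2 / t"
    define l where "l = (a * (1 - n) + (z $ 1 - c * z $ 2)) / (a + b)"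
    define m where "m = (b * (1 - n) - (z $ 1 - c * z $ 2)) / (a + b)"
    have nn: "n \<ge> 0" using True pos by (simp add: n_def)
    have "- a + z $ 2 * (c + a / t) \<le> z $ 1" "z $ 1 \<le> b + z $ 2 * (c - b / t)"
      using z True by auto
    then have ln: "l \<ge> 0" "m \<ge> 0"
      using pos by (auto simp: l_def m_def n_def algebra_simps)
    have sum: "l + m + n = 1"
      using segment_barycentric(1)[OF pos(1,2), of "1 - n"] by (simp add: l_def m_def)
    have lm: "l * b - m * a = z $ 1 - c * z $ 2"
      unfolding l_def m_def by (rule segment_barycentric(2)[OF pos(1,2)])
    have "n * t = z $ 2" using pos by (simp add: n_def)
    then have "z = l *\<^sub>R pt b 0 + m *\<^sub>R pt (- a) 0 + n *\<^sub>R pt (c * t) t"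
      using lm by (simp add: R2_eq_iff algebra_simps)
    then show ?thesis
      unfolding quad_def by (simp only:) (intro convex_hull_triangleI, auto simp: hull_inc nn ln sum)
  next
    case False
    define n where "n = - z $ 2 / s"
    define l where "l = (a * (1 - n) + (z $ 1 + d * z $ 2)) / (a + b)"
    define m where "m = (b * (1 - n) - (z $ 1 + d * z $ 2)) / (a + b)"
    have nn: "n \<ge> 0" using False pos by (simp add: n_def divide_nonpos_pos)
    have "- a + z $ 2 * (- d - a / s) \<le> z $ 1" "z $ 1 \<le> b + z $ 2 * (b / s - d)"
      using z False by auto
    then have ln: "l \<ge> 0" "m \<ge> 0"
      using pos by (auto simp: l_def m_def n_def algebra_simps)
    have sum: "l + m + n = 1"
      using segment_barycentric(1)[OF pos(1,2), of "1 - n"] by (simp add: l_def m_def)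
    have lm: "l * b - m * a = z $ 1 + d * z $ 2"
      unfolding l_def m_def by (rule segment_barycentric(2)[OF pos(1,2)])
    have "n * s = - z $ 2" using pos by (simp add: n_def)
    then have "z = l *\<^sub>R pt b 0 + m *\<^sub>R pt (- a) 0 + n *\<^sub>R pt (d * s) (- s)"
      using lm by (simp add: R2_eq_iff algebra_simps)
    then show ?thesis
      unfolding quad_def by (simp only:) (intro convex_hull_triangleI, auto simp: hull_inc nn ln sum)
  qed
  ultimately show ?thesis by blast
qed

text \<open>\<open>up\<close> and \<open>low\<close> say that the upper triangle of
  \<open>c', t'\<close> lies inside that of \<open>c, t\<close>, and the lower one of
  \<open>d', s'\<close> inside that of \<open>d, s\<close>. Hence combining a large half with a
  small half in both ways gives the large and the small quadrilateral.\<close>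

lemma quad_union_inter:
  assumes D: "quad_dom a b c t d s" and pos: "t' > 0" "s' > 0"
    and up: "c' - b / t' \<le> c - b / t" "c + a / t \<le> c' + a / t'"
    and low: "d' - b / s' \<le> d - b / s" "d + a / s \<le> d' + a / s'"
  shows "quad a b c t d' s' \<union> quad a b c' t' d s = quad a b c t d s"
    and "quad a b c t d' s' \<inter> quad a b c' t' d s = quad a b c' t' d' s'"
proof -
  have D1: "quad_dom a b c t d' s'" and D2: "quad_dom a b c' t' d s" and D3: "quad_dom a b c' t' d' s'"
    using D pos up low by (auto simp: quad_dom_def)
  have U: "- a + y * (c + a / t) \<le> x" "x \<le> b + y * (c - b / t)"
    if "y \<ge> 0" "- a + y * (c' + a / t') \<le> x" "x \<le> b + y * (c' - b / t')" for x y
    using mult_left_mono[OF up(1) that(1)] mult_left_mono[OF up(2) that(1)] that by linarith+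
  have "- d' - a / s' \<le> - d - a / s" "b / s - d \<le> b / s' - d'" using low by linarith+
  then have L: "- a + y * (- d - a / s) \<le> x" "x \<le> b + y * (b / s - d)"
    if "y \<le> 0" "- a + y * (- d' - a / s') \<le> x" "x \<le> b + y * (b / s' - d')" for x y
    using mult_left_mono_neg[of _ _ y] that by (meson add_left_mono order_trans)+
  show "quad a b c t d' s' \<union> quad a b c' t' d s = quad a b c t d s"
    unfolding quad_eq[OF D] quad_eq[OF D1] quad_eq[OF D2] 
    using U L by (auto simp del: mult_eq_0_iff) 
  show "quad a b c t d' s' \<inter> quad a b c' t' d s = quad a b c' t' d' s'"
    unfolding quad_eq[OF D3] quad_eq[OF D1] quad_eq[OF D2] 
    using U L by (auto simp del: mult_eq_0_iff) 
qed

section \<open>Valuation and symmetry relations on quadrilaterals\<close>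

locale covariant_valuation =
  fixes nu :: "R2 set \<Rightarrow> R2"
  assumes val: "is_valuation_on polygons_o nu"
    and cov: "\<And>A P. A \<in> VL2 \<Longrightarrow> P \<in> polygons_o \<Longrightarrow> nu ((*v) A ` P) = A *v nu P"
begin

abbreviation F :: "real \<Rightarrow> real \<Rightarrow> real \<Rightarrow> real \<Rightarrow> real \<Rightarrow> real \<Rightarrow> R2" where
  "F a b c t d s \<equiv> nu (quad a b c t d s)"

lemma F_nested:
  assumes D: "quad_dom a b c t d s" and pos: "t' > 0" "s' > 0"
    and up: "c' - b / t' \<le> c - b / t" "c + a / t \<le> c' + a / t'"
    and low: "d' - b / s' \<le> d - b / s" "d + a / s \<le> d' + a / s'"
  shows "F a b c t d s = F a b c t d' s' + F a b c' t' d s - F a b c' t' d' s'"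
proof -
  have "a > 0" "b > 0" "t > 0" "s > 0" using D by (auto simp: quad_dom_def)
  then have "quad a b c t d s \<in> polygons_o" "quad a b c t d' s' \<in> polygons_o"
      "quad a b c' t' d s \<in> polygons_o" "quad a b c' t' d' s' \<in> polygons_o"
    using pos by (auto intro: quad_in_polygons_o)
  then show ?thesis
    using val[unfolded is_valuation_on_def, rule_format,
        of "quad a b c t d' s'" "quad a b c' t' d s"] quad_union_inter[OF D pos up low]
    by (simp add: algebra_simps)
qed

text \<open>The effect of changing the upper vertex does not depend on the lower one:
  \<open>nu\<close> splits into an upper and a lower contribution. All four quadrilaterals are
  compared with a flat one contained in each of them.\<close>

lemma F_exchange:
  assumes D: "quad_dom a b c t d s" "quad_dom a b c' t' d s" "quad_dom a b c t d' s'"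
    "quad_dom a b c' t' d' s'"
  shows "F a b c t d s - F a b c' t' d s = F a b c t d' s' - F a b c' t' d' s'"
proof -
  have pos: "a > 0" "b > 0" "t > 0" "s > 0" "t' > 0" "s' > 0"
    using D by (auto simp: quad_dom_def)
  \<comment> \<open>\<open>M\<close> bounds all edge parameters involved, and \<open>r\<close> is so
    small that \<open>a / r\<close> and \<open>b / r\<close> exceed it; thus the vertices
    \<open>pt 0 r\<close> and \<open>pt 0 (- r)\<close> span triangles inside all the given
    halves.\<close>
  define M where "M = \<bar>c\<bar> + \<bar>c'\<bar> + \<bar>d\<bar> + \<bar>d'\<bar> + a / t + a / t' + a / s + a / s' + b / t + b / t' + b / s + b / s'"
  define r where "r = min a b / (M + 1)"
  have nn: "0 \<le> a / t" "0 \<le> a / t'" "0 \<le> a / s" "0 \<le> a / s'" "0 \<le> b / t" "0 \<le> b / t'" "0 \<le> b / s" "0 \<le> b / s'"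
    using pos by auto
  then have M: "M \<ge> 0" by (simp add: M_def)
  have r: "r > 0" using M pos by (simp add: r_def)
  have "M + 1 \<le> a / r" "M + 1 \<le> b / r" 
    using M pos by (auto simp: r_def pos_le_divide_eq min_def)
  then have *: "0 - b / r \<le> x - y" "x + y \<le> 0 + a / r" if "\<bar>x\<bar> + y \<le> M" for x y
    using that by auto
  have in_M: "\<bar>c\<bar> + b / t \<le> M" "\<bar>c\<bar> + a / t \<le> M" "\<bar>c'\<bar> + b / t' \<le> M" "\<bar>c'\<bar> + a / t' \<le> M"
    "\<bar>d\<bar> + b / s \<le> M" "\<bar>d\<bar> + a / s \<le> M" "\<bar>d'\<bar> + b / s' \<le> M" "\<bar>d'\<bar> + a / s' \<le> M"
    using nn by (auto simp: M_def)
  have "F a b c t d s = F a b c t 0 r + F a b 0 r d s - F a b 0 r 0 r"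
    "F a b c' t' d s = F a b c' t' 0 r + F a b 0 r d s - F a b 0 r 0 r"
    "F a b c t d' s' = F a b c t 0 r + F a b 0 r d' s' - F a b 0 r 0 r"
    "F a b c' t' d' s' = F a b c' t' 0 r + F a b 0 r d' s' - F a b 0 r 0 r"
    using D r by (intro F_nested * in_M; simp)+
  then show ?thesis by simp
qed

lemma F_linear_image:
  assumes "a > 0" "b > 0" "t > 0" "s > 0" "A \<in> VL2"
    and "(*v) A ` {pt b 0, pt (- a) 0, pt (c * t) t, pt (d * s) (- s)}
        = {pt b' 0, pt (- a') 0, pt (c' * t') t', pt (d' * s') (- s')}"
  shows "F a' b' c' t' d' s' = A *v F a b c t d s"
proof -
  have "(*v) A ` quad a b c t d s = quad a' b' c' t' d' s'"
    unfolding quad_def matrix_image_hull assms(6) ..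
  then show ?thesis
    using cov[OF assms(5) quad_in_polygons_o[OF assms(1-4)], of c d] by simp
qed

lemma F_shear:
  assumes "a > 0" "b > 0" "t > 0" "s > 0"
  shows "F a b (c + e) t (d - e) s $ 1 = F a b c t d s $ 1 + e * F a b c t d s $ 2"
    and "F a b (c + e) t (d - e) s $ 2 = F a b c t d s $ 2"
proof -
  have "F a b (c + e) t (d - e) s = mat2 1 e 0 1 *v F a b c t d s"
    by (rule F_linear_image) (use assms in \<open>auto simp: VL2_def algebra_simps\<close>)
  then show "F a b (c + e) t (d - e) s $ 1 = F a b c t d s $ 1 + e * F a b c t d s $ 2"
    "F a b (c + e) t (d - e) s $ 2 = F a b c t d s $ 2"
    by (auto simp: mult_R2_nth)
qed

lemma F_flip:
  assumes "a > 0" "b > 0" "t > 0" "s > 0"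
  shows "F a b d s c t $ 1 = F a b c t d s $ 1" "F a b d s c t $ 2 = - F a b c t d s $ 2"
proof -
  have "F a b d s c t = mat2 1 0 0 (-1) *v F a b c t d s"
    by (rule F_linear_image) (use assms in \<open>auto simp: VL2_def\<close>)
  then show "F a b d s c t $ 1 = F a b c t d s $ 1" "F a b d s c t $ 2 = - F a b c t d s $ 2"
    by (auto simp: mult_R2_nth)
qed

lemma F_mirror:
  assumes "a > 0" "b > 0" "t > 0" "s > 0"
  shows "F b a (- c) t (- d) s $ 1 = - F a b c t d s $ 1"
proof -
  have "F b a (- c) t (- d) s = mat2 (-1) 0 0 1 *v F a b c t d s"
    by (rule F_linear_image) (use assms in \<open>auto simp: VL2_def\<close>)
  then show ?thesis by (auto simp: mult_R2_nth)
qed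

lemma F_scale:
  assumes "a > 0" "b > 0" "t > 0" "s > 0" "l > 0"
  shows "F (l * a) (l * b) (l\<^sup>2 * c) (t / l) (l\<^sup>2 * d) (s / l) $ 1 = l * F a b c t d s $ 1"
proof -
  have "F (l * a) (l * b) (l\<^sup>2 * c) (t / l) (l\<^sup>2 * d) (s / l) = mat2 l 0 0 (1 / l) *v F a b c t d s"
    by (rule F_linear_image) (use assms in \<open>auto simp: VL2_def power2_eq_square\<close>)
  then show ?thesis by (auto simp: mult_R2_nth)
qed

text \<open>For \<open>c = d = 0\<close> both diagonals lie on the axes, so the reflection in the
  line \<open>x = y\<close> stays in the family and exchanges the two diagonals.\<close>

lemma F_swap:
  assumes "a > 0" "b > 0" "t > 0" "s > 0"
  shows "F s t 0 b 0 a $ 2 = F a b 0 t 0 s $ 1"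
proof -
  have "F s t 0 b 0 a = mat2 0 1 1 0 *v F a b 0 t 0 s"
    by (rule F_linear_image) (use assms in \<open>auto simp: VL2_def\<close>)
  then show ?thesis by (auto simp: mult_R2_nth)
qed

text \<open>Two descriptions of one triangle with the origin in its interior: cut along the line
  through one vertex, or (after a quarter turn) along the line through another.\<close>
lemma F_triangle:
  assumes "b > 0" "t > 0" "s > 0"
    and d: "d = b * (1 / s + 1 / t)" and b': "b' = s / (d * s + 1)"
  shows "F t b' (1 / d) (d * s) 0 1 $ 1 = - F 1 b 0 t d s $ 2"
proof -
  have "d > 0" using assms by (simp add: add_pos_pos)
  have pos: "d * s > 0" "b' > 0" using assms \<open>d > 0\<close> by (auto intro!: divide_pos_pos add_pos_pos)
  \<comment> \<open>The value of \<open>d\<close> puts \<open>pt b 0\<close> on the edge between the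
    upper and the lower vertex, so the quadrilateral is a triangle.\<close>
  have "pt b 0 = (s / (s + t)) *\<^sub>R pt 0 t + (t / (s + t)) *\<^sub>R pt (d * s) (- s) + 0 *\<^sub>R pt (-1) 0"
    using assms by (simp add: R2_eq_iff field_simps)
  also have "\<dots> \<in> convex hull {pt (- 1) 0, pt 0 t, pt (d * s) (- s)}"
    using assms by (intro convex_hull_triangleI) (auto simp: hull_inc add_divide_distrib[symmetric])
  finally have q1: "quad 1 b 0 t d s = convex hull {pt (- 1) 0, pt 0 t, pt (d * s) (- s)}"
    by (simp add: quad_def hull_redundant)
  \<comment> \<open>After the quarter turn the horizontal axis meets the image of the triangle in
    \<open>pt (- t) 0\<close> and in the point \<open>pt b' 0\<close> of the opposite edge.\<close>
  have "pt b' 0 = (1 / (d * s + 1)) *\<^sub>R pt s (d * s) + (d * s / (d * s + 1)) *\<^sub>R pt 0 (- 1) + 0 *\<^sub>R pt (- t) 0"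
    by (simp add: R2_eq_iff b')
  also have "\<dots> \<in> convex hull {pt (- t) 0, pt s (d * s), pt 0 (- 1)}"
    using pos by (intro convex_hull_triangleI) (auto simp: hull_inc add_divide_distrib[symmetric])
  finally have q2: "quad t b' (1 / d) (d * s) 0 1 = convex hull {pt (- t) 0, pt s (d * s), pt 0 (- 1)}"
    using \<open>d > 0\<close> by (simp add: quad_def hull_redundant)
  have "(*v) (mat2 0 (-1) 1 0) ` quad 1 b 0 t d s = quad t b' (1 / d) (d * s) 0 1"
    unfolding q1 q2 matrix_image_hull by (simp add: insert_commute)
  then have "F t b' (1 / d) (d * s) 0 1 = mat2 0 (-1) 1 0 *v F 1 b 0 t d s"
    using cov[of "mat2 0 (-1) 1 0" "quad 1 b 0 t d s"] quad_in_polygons_o[of 1 b t s] assms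
    by (simp add: VL2_def)
  then show ?thesis by (simp add: mult_R2_nth)
qed

end

text \<open>This weak regularity follows from measurability, and for the moment vector from
  local boundedness; by Steinhaus' theorem it suffices to make additive functions linear.\<close>
locale regular_covariant_valuation = covariant_valuation +
  assumes reg: "\<And>a b t s. a > 0 \<Longrightarrow> b > 0 \<Longrightarrow> t > 0 \<Longrightarrow> s > 0 \<Longrightarrow>
    \<exists>A \<in> sets lebesgue. A \<subseteq> {-1..1} \<and> emeasure lebesgue A > 0 \<and>
      bounded ((\<lambda>c. nu (quad a b c t 0 s) $ 1) ` A)"
begin

section \<open>Linear dependence on the vertices, and its slope\<close>

text \<open>This is \<open>q(a, b, t)\<close> of the introduction. By \<open>F_exchange\<close>
  every admissible lower vertex gives the same value; the height \<open>min a b / 2\<close> is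
  admissible for every \<open>t\<close>.\<close>

definition slope :: "real \<Rightarrow> real \<Rightarrow> real \<Rightarrow> real" where
  "slope a b t = (F a b 1 t 0 (min a b / 2) - F a b 0 t 0 (min a b / 2)) $ 1"

text \<open>The change \<open>e x\<close> caused by moving the upper parameter from 0 to
  \<open>x\<close> is a cocycle under shears. Commutativity of addition makes its second coordinate
  linear and a reflection makes it 0; the first coordinate is then additive, and linear by
  \<open>reg\<close>.\<close>

lemma F_slope:
  assumes D: "quad_dom a b c t 0 s"
  shows "F a b c t 0 s $ 1 = F a b 0 t 0 s $ 1 + c * slope a b t"
    and "F a b c t 0 s $ 2 = F a b 0 t 0 s $ 2"
proof -
  have pos: "a > 0" "b > 0" "t > 0" "s > 0"
    using D by (auto simp: quad_dom_def)
  define m where "m = min a b"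
  have m: "m > 0" "m \<le> a" "m \<le> b" using pos by (auto simp: m_def)
  have dom: "quad_dom a b x t y r" if r: "r > 0" "r * (\<bar>x\<bar> + \<bar>y\<bar>) \<le> m" for x y r
  proof -
    have "\<bar>x\<bar> + \<bar>y\<bar> \<le> m / r" using r by (simp add: pos_le_divide_eq mult.commute)
    moreover have "m / r \<le> a / r" "m / r \<le> b / r" using m r by (auto intro: divide_right_mono)
    moreover have "0 < a / t" "0 < b / t" using pos by auto
    ultimately have "x - b / t \<le> b / r - y" "- y - a / r \<le> x + a / t" by linarith+
    then show ?thesis using pos r by (simp add: quad_dom_def)
  qed
  \<comment> \<open>The height \<open>m / (1 + \<bar>x\<bar>)\<close> is low enough for convex
    position; \<open>e_indep\<close> frees \<open>e\<close> from this choice.\<close>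
  define e where "e x = F a b x t 0 (m / (1 + \<bar>x\<bar>)) - F a b 0 t 0 (m / (1 + \<bar>x\<bar>))" for x
  have e_indep: "e x = F a b x t 0 r - F a b 0 t 0 r" if "quad_dom a b x t 0 r" for x r
  proof -
    have r: "r > 0" using that by (auto simp: quad_dom_def)
    have "quad_dom a b x t 0 (m / (1 + \<bar>x\<bar>))"
      using m by (intro dom) (auto simp: field_simps)
    moreover have "quad_dom a b 0 t 0 (m / (1 + \<bar>x\<bar>))" "quad_dom a b 0 t 0 r"
      using m r by (auto intro: dom)
    ultimately show ?thesis unfolding e_def using that by (intro F_exchange)
  qed
  \<comment> \<open>The shear by \<open>y\<close> takes the upper and lower parameters
    \<open>x, y\<close> to \<open>x + y, 0\<close> and \<open>0, y\<close> to \<open>y, 0\<close>.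
    So it carries the change from 0 to \<open>x\<close> into the change from \<open>y\<close> to
    \<open>x + y\<close>.\<close>
  have cocycle: "e (x + y) $ 1 = e x $ 1 + y * e x $ 2 + e y $ 1" "e (x + y) $ 2 = e x $ 2 + e y $ 2" for x y
  proof -
    define r where "r = m / (1 + \<bar>x\<bar> + \<bar>y\<bar>)"
    have r: "r > 0" "r * (1 + \<bar>x\<bar> + \<bar>y\<bar>) = m" using m by (auto simp: r_def)
    have le: "r * u \<le> m" if "u \<le> \<bar>x\<bar> + \<bar>y\<bar>" for u
    proof -
      have "r * u \<le> r * (1 + \<bar>x\<bar> + \<bar>y\<bar>)" using r that by (intro mult_left_mono) auto
      then show ?thesis using r by simp
    qed
    have doms: "quad_dom a b (x + y) t 0 r" "quad_dom a b y t 0 r" "quad_dom a b x t 0 r"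
      "quad_dom a b 0 t 0 r" "quad_dom a b x t y r" "quad_dom a b 0 t y r"
      using r by (auto intro!: dom le)
    have ex: "F a b x t y r - F a b 0 t y r = e x"
      using F_exchange[OF doms(5,6,3,4)] e_indep[OF doms(3)] by simp
    have "e (x + y) = F a b (x + y) t 0 r - F a b 0 t 0 r" "e y = F a b y t 0 r - F a b 0 t 0 r"
      using e_indep doms by auto
    then have "e (x + y) - e y = F a b (x + y) t (y - y) r - F a b (0 + y) t (y - y) r" by simp
    moreover have "(F a b (x + y) t (y - y) r - F a b (0 + y) t (y - y) r) $ 1
        = e x $ 1 + y * e x $ 2"
      unfolding vector_minus_component F_shear[OF pos(1-3) r(1)] ex[symmetric]
      by (simp add: algebra_simps)
    moreover have "(F a b (x + y) t (y - y) r - F a b (0 + y) t (y - y) r) $ 2 = e x $ 2"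
      unfolding vector_minus_component F_shear[OF pos(1-3) r(1)] ex[symmetric] by simp
    ultimately have "(e (x + y) - e y) $ 1 = e x $ 1 + y * e x $ 2" "(e (x + y) - e y) $ 2 = e x $ 2"
      by metis+
    then show "e (x + y) $ 1 = e x $ 1 + y * e x $ 2 + e y $ 1" "e (x + y) $ 2 = e x $ 2 + e y $ 2"
      by auto
  qed
  \<comment> \<open>The cocycle expands \<open>x + 1\<close> and \<open>1 + x\<close> differently;
    equating the first coordinates gives linearity of the second.\<close>
  have e2_lin: "e x $ 2 = x * e 1 $ 2" for x
    using cocycle(1)[of x 1] cocycle(1)[of 1 x] by (simp add: add.commute)
  have "e (m / t) $ 2 = 0"
  proof -
    \<comment> \<open>At equal heights the shear by \<open>- x\<close> followed by the flip maps the
      quadrilateral to itself, while it negates the second coordinate of \<open>nu\<close>.\<close>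
    have flip0: "F a b x t 0 t $ 2 = 0" for x
      using F_shear(2)[of a b t t x "- x" 0] F_flip(2)[of a b t t 0 x] pos by simp
    have "quad_dom a b (m / t) t 0 t" using m pos by (intro dom) auto
    from e_indep[OF this] show ?thesis using flip0 by simp
  qed
  then have e2: "e x $ 2 = 0" for x
    using e2_lin[of "m / t"] e2_lin[of x] m pos by simp
  obtain A where A: "A \<in> sets lebesgue" "A \<subseteq> {-1..1}" "emeasure lebesgue A > 0"
      and bnd: "bounded ((\<lambda>c. F a b c t 0 m $ 1) ` A)"
    using reg[OF pos(1-3) m(1)] by blast
  have e1_A: "e x $ 1 = F a b x t 0 m $ 1 - F a b 0 t 0 m $ 1" if "x \<in> A" for x
  proof -
    have "\<bar>x\<bar> \<le> 1" using A that by force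
    then have "quad_dom a b x t 0 m" using m by (intro dom) (auto simp: mult_left_le)
    from e_indep[OF this] show ?thesis by simp
  qed
  obtain B where B: "\<And>x. x \<in> A \<Longrightarrow> \<bar>F a b x t 0 m $ 1\<bar> \<le> B"
    using bnd by (auto simp: bounded_iff)
  have "bounded ((\<lambda>x. e x $ 1) ` A)"
    unfolding bounded_iff
  proof (intro exI ballI)
    fix y assume "y \<in> (\<lambda>x. e x $ 1) ` A"
    then obtain x where x: "x \<in> A" "y = e x $ 1" by blast
    then show "norm y \<le> B + \<bar>F a b 0 t 0 m $ 1\<bar>"
      using e1_A[OF x(1)] B[OF x(1)] by simp
  qed
  moreover have "bounded A" using A(2) bounded_subset bounded_closed_interval by blast
  ultimately have e1: "e x $ 1 = x * e 1 $ 1" for x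
    using A cocycle(1) e2 by (intro additive_bounded_imp_linear[where A = A]) auto
  have "e 1 $ 1 = slope a b t" by (simp add: e_def slope_def m_def)
  then show "F a b c t 0 s $ 1 = F a b 0 t 0 s $ 1 + c * slope a b t"
    using e1[of c] e_indep[OF D] by simp
  show "F a b c t 0 s $ 2 = F a b 0 t 0 s $ 2"
    using e2[of c] e_indep[OF D] by simp
qed

text \<open>A flip and a shear back relate \<open>F a b c t 0 s\<close> to
  \<open>F a b c s 0 t\<close>. Both first coordinates are linear in \<open>c\<close>, and the shear
  contributes \<open>c\<close> times the second coordinate; comparing coefficients of
  \<open>c\<close> determines it.\<close>

lemma F_symmetric_2:
  assumes pos: "a > 0" "b > 0" "t > 0" "s > 0"
  shows "F a b 0 t 0 s $ 2 = slope a b t - slope a b s"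
proof -
  define c where "c = b / t"
  have c: "c > 0" using pos by (simp add: c_def)
  have D: "quad_dom a b c t 0 s" "quad_dom a b c s 0 t"
    using pos by (auto simp: quad_dom_def c_def intro: order_trans[of _ 0])
  have "F a b c s 0 t $ 1 = F a b c t 0 s $ 1 - c * F a b c t 0 s $ 2"
    using F_shear(1)[of a b t s c "- c" 0] F_flip(1)[of a b t s c 0] pos by simp
  moreover have "F a b 0 s 0 t $ 1 = F a b 0 t 0 s $ 1"
    using F_flip(1) pos by simp
  ultimately have "c * slope a b s = c * (slope a b t - F a b 0 t 0 s $ 2)"
    using F_slope[OF D(1)] F_slope[OF D(2)] by (simp add: algebra_simps)
  then show ?thesis using c by simp
qed

lemma F_symmetric_1:
  assumes pos: "a > 0" "b > 0" "t > 0" "s > 0"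
  shows "F a b 0 t 0 s $ 1 = slope s t b - slope s t a"
  using F_swap[OF pos] F_symmetric_2[of s t b a] pos by simp

text \<open>A shear by \<open>d\<close> moves the lower vertex onto the vertical axis, where
  \<open>F_slope\<close> and the symmetric case apply.\<close>

lemma F_eq_slope:
  assumes D: "quad_dom a b c t d s"
  shows "F a b c t d s $ 1 = slope s t b - slope s t a + c * slope a b t + d * slope a b s"
    and "F a b c t d s $ 2 = slope a b t - slope a b s"
proof -
  have pos: "a > 0" "b > 0" "t > 0" "s > 0" and D': "quad_dom a b (c + d) t 0 s"
    using D by (auto simp: quad_dom_def)
  note sh = F_shear[OF pos, of c d d, simplified]
  show 2: "F a b c t d s $ 2 = slope a b t - slope a b s"
    using sh(2) F_slope(2)[OF D'] F_symmetric_2[OF pos] by simp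
  show "F a b c t d s $ 1 = slope s t b - slope s t a + c * slope a b t + d * slope a b s"
    using sh(1) 2 F_slope(1)[OF D'] F_symmetric_1[OF pos] by (simp add: algebra_simps)
qed

text \<open>The hypotheses of \<open>kernel_functional_equation\<close> are the symmetries in
  disguise: \<open>sym\<close> comes from the mirror image, \<open>hom\<close> from scaling,
  \<open>sep\<close> from \<open>F_exchange\<close> at symmetric quadrilaterals, and
  \<open>tri\<close> from the two descriptions of a triangle.\<close>

lemma slope_quadratic:
  obtains C where "\<And>a b t. a > 0 \<Longrightarrow> b > 0 \<Longrightarrow> t > 0 \<Longrightarrow> slope a b t = C * t\<^sup>2 * (a + b)"
proof -
  have sym: "slope a b t = slope b a t" if pos: "a > 0" "b > 0" "t > 0" for a b t
  proof -
    define c where "c = b / t"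
    have c: "c > 0" using pos by (simp add: c_def)
    have "b / t > 0" "a / t > 0" using pos by auto
    then have D: "quad_dom a b c t 0 1" "quad_dom b a (- c) t 0 1"
      unfolding quad_dom_def c_def using pos by (intro conjI; linarith)+
    have "c * slope a b t = c * slope b a t"
      using F_slope(1)[OF D(1)] F_slope(1)[OF D(2)] F_mirror[of a b t 1 c 0]
        F_mirror[of a b t 1 0 0] pos by auto
    then show ?thesis using c by simp
  qed
  have hom: "slope (l * a) (l * b) (t / l) = slope a b t / l"
    if pos: "l > 0" "a > 0" "b > 0" "t > 0" for l a b t
  proof -
    define c where "c = b / t"
    have c: "c > 0" using pos by (simp add: c_def)
    have D: "quad_dom a b c t 0 1" "quad_dom (l * a) (l * b) (l\<^sup>2 * c) (t / l) 0 (1 / l)"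
      using pos by (auto simp: quad_dom_def c_def power2_eq_square intro: order_trans[of _ 0])
    have "l\<^sup>2 * c * slope (l * a) (l * b) (t / l) = l * (c * slope a b t)"
      using F_slope(1)[OF D(1)] F_slope(1)[OF D(2)] F_scale[of a b t 1 l c 0]
        F_scale[of a b t 1 l 0 0] pos by (simp add: algebra_simps)
    then show ?thesis using c pos by (simp add: field_simps power2_eq_square)
  qed
  have sep: "2 * (slope s t b - slope s t a) = (slope t t b - slope t t a) + (slope s s b - slope s s a)"
    if pos: "a > 0" "b > 0" "s > 0" "t > 0" for a b s t
  proof -
    have "quad_dom a b 0 u 0 v" if "u > 0" "v > 0" for u v
      using pos that by (auto simp: quad_dom_def intro: order_trans[of _ 0])
    then have "F a b 0 t 0 s - F a b 0 s 0 s = F a b 0 t 0 t - F a b 0 s 0 t"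
      using pos by (intro F_exchange) auto
    then have "(F a b 0 t 0 s - F a b 0 s 0 s) $ 1 = (F a b 0 t 0 t - F a b 0 s 0 t) $ 1" by simp
    then show ?thesis using pos sym[of t s] by (simp add: F_symmetric_1)
  qed
  have tri: "slope 1 (b * (s + t) / t) (s / (b * (s + t) / t + 1)) - slope 1 (b * (s + t) / t) t
          + s / (b * (s + t) / t) * slope t (s / (b * (s + t) / t + 1)) (b * (s + t) / t)
        = slope 1 b s - slope 1 b t"
    if pos: "b > 0" "s > 0" "t > 0" for b s t
  proof -
    define d where "d = b * (1 / s + 1 / t)"
    define b' where "b' = s / (d * s + 1)"
    have ds: "b * (s + t) / t = d * s" and d: "d > 0"
      using pos by (auto simp: d_def field_simps add_pos_pos)
    have b'_pos: "b' > 0" using pos d by (simp add: b'_def add_pos_pos)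
    have "d * s > 0" using pos d by simp
    then have "b' * (d * s + 1) = s" unfolding b'_def by simp
    moreover have "b' + b' / (d * s) = b' * (d * s + 1) / (d * s)"
      using pos d by (simp add: add_divide_distrib distrib_left)
    \<comment> \<open>This is the boundary case of \<open>quad_dom\<close>: the right vertex lies on
      an edge, so one of its inequalities is an equality.\<close>
    ultimately have "1 / d = b' + b' / (d * s)" using pos d by simp
    moreover have "b' / (d * s) > 0" "t / (d * s) > 0" using pos b'_pos \<open>d * s > 0\<close> by auto
    ultimately have "quad_dom t b' (1 / d) (d * s) 0 1"
      unfolding quad_dom_def using pos b'_pos \<open>d * s > 0\<close> by (intro conjI; linarith)
    moreover have "quad_dom 1 b 0 t d s"
    proof -
      have "d = b / s + b / t" by (simp add: d_def distrib_left)
      moreover have "1 / s > 0" "1 / t > 0" using pos by auto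
      ultimately show ?thesis unfolding quad_dom_def using pos d by (intro conjI; linarith)
    qed
    ultimately have "slope 1 (d * s) b' - slope 1 (d * s) t + 1 / d * slope t b' (d * s)
        = slope 1 b s - slope 1 b t"
      using F_triangle[OF pos(1,3,2) d_def b'_def] by (simp add: F_eq_slope)
    then show ?thesis using pos d by (simp add: ds b'_def)
  qed
  from kernel_functional_equation[of slope, OF sym hom sep tri] that show thesis by blast
qed

lemma F_eq:
  obtains C where "\<And>a b c t d s. quad_dom a b c t d s \<Longrightarrow>
    F a b c t d s = C *\<^sub>R pt ((b\<^sup>2 - a\<^sup>2) * (s + t) + (a + b) * (c * t\<^sup>2 + d * s\<^sup>2)) ((a + b) * (t\<^sup>2 - s\<^sup>2))"
proof -
  obtain C where C: "\<And>a b t. a > 0 \<Longrightarrow> b > 0 \<Longrightarrow> t > 0 \<Longrightarrow> slope a b t = C * t\<^sup>2 * (a + b)"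
    using slope_quadratic by blast
  show thesis
  proof
    fix a b c t d s assume D: "quad_dom a b c t d s"
    then have "a > 0" "b > 0" "t > 0" "s > 0" by (auto simp: quad_dom_def)
    then show "F a b c t d s = C *\<^sub>R pt ((b\<^sup>2 - a\<^sup>2) * (s + t) + (a + b) * (c * t\<^sup>2 + d * s\<^sup>2)) ((a + b) * (t\<^sup>2 - s\<^sup>2))"
      using F_eq_slope[OF D] by (simp add: R2_eq_iff C algebra_simps)
  qed
qed

end

section \<open>Reduction of polygons to quadrilaterals\<close>

text \<open>The line \<open>l \<bullet> p = 1\<close> separates \<open>c\<close> from
  \<open>b\<close>; the crossing point \<open>f\<close> splits the segment, so \<open>z\<close> can
  be assigned to the part on its own side.\<close>

lemma segment_crossing:
  fixes c b z l :: "'a::real_inner"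
  assumes z: "z \<in> closed_segment c b" and c: "l \<bullet> c > 1" and b: "l \<bullet> b \<le> 1"
  obtains f where "f \<in> closed_segment c b" "l \<bullet> f = 1"
    "l \<bullet> z \<le> 1 \<Longrightarrow> z \<in> closed_segment f b" "l \<bullet> z \<ge> 1 \<Longrightarrow> z \<in> closed_segment c f"
proof -
  obtain v where v: "0 \<le> v" "v \<le> 1" "z = (1 - v) *\<^sub>R c + v *\<^sub>R b"
    using z by (auto simp: in_segment)
  define g where "g = l \<bullet> c - l \<bullet> b"
  have g: "g > 0" using c b by (simp add: g_def)
  define k where "k = (l \<bullet> c - 1) / g"
  have k: "0 < k" "k \<le> 1" "k * g = l \<bullet> c - 1" using c b g by (auto simp: k_def g_def)
  define f where "f = (1 - k) *\<^sub>R c + k *\<^sub>R b"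
  have lin: "l \<bullet> ((1 - r) *\<^sub>R c + r *\<^sub>R b) = l \<bullet> c - r * g" for r
    by (simp add: g_def inner_add_right algebra_simps)
  have f: "l \<bullet> f = 1" using k(3) by (simp only: f_def lin)
  have lz: "l \<bullet> z = 1 + (k - v) * g" using k(3) by (simp only: v lin) (simp add: algebra_simps)
  show thesis
  proof
    show "f \<in> closed_segment c b" using k by (auto simp: in_segment f_def intro!: exI[of _ k])
    show "l \<bullet> f = 1" by fact
    show "z \<in> closed_segment f b" if "l \<bullet> z \<le> 1"
    proof -
      have kv: "k \<le> v" using that g by (simp add: lz mult_le_0_iff)
      show ?thesis
      proof (cases "k = 1")
        case True
        then show ?thesis using kv v f_def by simp
      next
        case False
        define m where "m = (v - k) / (1 - k)"
        have m: "0 \<le> m" "m \<le> 1" "m * (1 - k) = v - k" using False k kv v by (auto simp: m_def)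
        have "(1 - m) * (1 - k) = 1 - v" "(1 - m) * k + m = v"
          using m(3) by (auto simp: algebra_simps)
        then have "z = (1 - m) *\<^sub>R f + m *\<^sub>R b"
          unfolding v f_def scaleR_add_right scaleR_scaleR
          by (simp add: add.assoc scaleR_add_left[symmetric])
        then show ?thesis using m by (auto simp: in_segment)
      qed
    qed
    show "z \<in> closed_segment c f" if "l \<bullet> z \<ge> 1"
    proof -
      have kv: "v \<le> k" using that g by (simp add: lz zero_le_mult_iff)
      define m where "m = v / k"
      have m: "0 \<le> m" "m \<le> 1" "m * k = v" using k kv v by (auto simp: m_def)
      then have "(1 - m) + m * (1 - k) = 1 - v" by (simp add: algebra_simps)
      then have "z = (1 - m) *\<^sub>R c + m *\<^sub>R f"
        unfolding v f_def scaleR_add_right scaleR_scaleR m(3)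
        by (metis add.assoc scaleR_add_left)
      then show ?thesis using m by (auto simp: in_segment)
    qed
  qed
qed

lemma convex_hull_insert_segment:
  assumes z: "z \<in> convex hull (insert c S)" and "S \<noteq> {}"
  obtains b where "b \<in> convex hull S" "z \<in> closed_segment c b"
proof -
  obtain u v b where "u \<ge> 0" "v \<ge> 0" "u + v = 1" "b \<in> convex hull S" "z = u *\<^sub>R c + v *\<^sub>R b"
    using z convex_hull_insert[OF \<open>S \<noteq> {}\<close>, of c] by auto
  moreover have "u = 1 - v" using \<open>u + v = 1\<close> by simp
  ultimately show thesis using that[of b] by (auto simp: in_segment)
qed

text \<open>The ray leaves the polygon at a boundary point. A supporting functional there can be
  normalised to the value 1, since the origin is interior; its face is a segment, and the endpoints
  are extreme points, hence in \<open>S\<close>.\<close>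

lemma polygon_facet_on_ray:
  fixes S :: "R2 set"
  assumes S: "finite S" and int: "0 \<in> interior (convex hull S)" and z: "z \<noteq> 0"
  obtains r x y l where "r > 0" "x \<in> S" "y \<in> S" "r *\<^sub>R z \<in> closed_segment x y"
    "\<And>p. p \<in> convex hull S \<Longrightarrow> l \<bullet> p \<le> 1" "l \<bullet> x = 1" "l \<bullet> y = 1"
proof -
  let ?A = "convex hull S"
  have comp: "compact ?A" using S by (simp add: finite_imp_compact_convex_hull)
  obtain r where r: "r > 0" "r *\<^sub>R z \<in> frontier ?A"
    using ray_to_frontier[OF compact_imp_bounded[OF comp] int z] by (metis add_0)
  define e where "e = r *\<^sub>R z"
  have e: "e \<in> ?A" "e \<notin> interior ?A"
    using r closure_closed[OF compact_imp_closed[OF comp]] by (auto simp: e_def frontier_def)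
  have "rel_interior ?A = interior ?A"
    using int by (intro rel_interior_nonempty_interior) auto
  then have "e \<notin> rel_interior ?A" "e \<in> closure ?A" using e closure_subset by auto
  then obtain a where a: "a \<noteq> 0" "\<And>y. y \<in> closure ?A \<Longrightarrow> a \<bullet> e \<le> a \<bullet> y"
    using supporting_hyperplane_relative_frontier[OF convex_convex_hull] by metis
  obtain y0 where "y0 \<in> ?A" "a \<bullet> y0 < 0"
    using int a(1) zero_in_interior_iff[of ?A] by auto
  then have neg: "a \<bullet> e < 0" using a(2)[of y0] closure_subset[of ?A] by (meson in_mono order_le_less_trans)
  define l where "l = (1 / (a \<bullet> e)) *\<^sub>R a"
  have le: "l \<bullet> e = 1" using neg by (simp add: l_def)
  have l1: "l \<bullet> p \<le> 1" if "p \<in> ?A" for p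
    using a(2)[of p] that neg closure_subset[of ?A] by (auto simp: l_def divide_le_eq subset_iff)
  have "l \<noteq> 0" using le by auto
  define T where "T = ?A \<inter> {p. l \<bullet> p = 1}"
  have face: "T face_of ?A"
    unfolding T_def by (intro face_of_Int_supporting_hyperplane_le l1) auto
  obtain S' where S': "S' \<subseteq> S" "T = convex hull S'"
    using face_of_convex_hull_subset[OF finite_imp_compact[OF S] face] by blast
  have "e \<in> T" using e le by (simp add: T_def)
  have "compact T" "convex T"
    unfolding T_def using comp by (auto intro: compact_Int_closed closed_hyperplane convex_Int convex_hyperplane)
  moreover have "collinear T"
  proof -
    have "aff_dim T \<le> aff_dim {p. l \<bullet> p = 1}" unfolding T_def by (intro aff_dim_subset) auto
    also have "\<dots> = 1" using \<open>l \<noteq> 0\<close> by (simp add: aff_dim_hyperplane)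
    finally show ?thesis by (simp add: collinear_aff_dim)
  qed
  ultimately obtain x y where xy: "T = closed_segment x y"
    using compact_convex_collinear_segment[of T] \<open>e \<in> T\<close> by blast
  have "x extreme_point_of T" "y extreme_point_of T" unfolding xy extreme_point_of_segment by auto
  then have "x \<in> S'" "y \<in> S'" unfolding S'(2) by (auto dest: extreme_point_of_convex_hull)
  moreover have "l \<bullet> x = 1" "l \<bullet> y = 1" using xy unfolding T_def by (auto simp: set_eq_iff)
  ultimately show thesis
    using that[of r x y l] r(1) l1 S'(1) \<open>e \<in> T\<close> xy e_def by blast
qed

section \<open>Quadrilaterals with a diagonal on an arbitrary line through the origin\<close>

definition cross :: "R2 \<Rightarrow> R2 \<Rightarrow> real" where
  "cross x y = x $ 1 * y $ 2 - x $ 2 * y $ 1"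

lemma cross_simps [simp]:
  "cross x (y + z) = cross x y + cross x z" "cross x (r *\<^sub>R y) = r * cross x y"
  "cross (r *\<^sub>R x) y = r * cross x y" "cross x x = 0" "cross x (- y) = - cross x y" "cross x 0 = 0"
  by (auto simp: cross_def algebra_simps)

text \<open>The inner product is expanded in the orthogonal frame of \<open>p\<close> and its
  quarter turn. For \<open>w\<close> orthogonal to \<open>p\<close> only the second product remains,
  so \<open>cross\<close> decides the sign of \<open>w \<bullet> u\<close>.\<close>

lemma inner_cross_identity: "(p \<bullet> p) * (w \<bullet> u) = (p \<bullet> w) * (p \<bullet> u) + cross p w * cross p u"
  by (simp add: inner_R2 cross_def algebra_simps)

lemma cross_eq_0_imp_scaleR:
  assumes "cross p u = 0" "p \<noteq> 0"
  obtains r where "u = r *\<^sub>R p"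
proof
  have N: "p $ 1 * p $ 1 + p $ 2 * p $ 2 \<noteq> 0"
    using assms(2) by (simp add: R2_eq_iff sum_squares_eq_zero_iff)
  have c: "p $ 1 * u $ 2 = p $ 2 * u $ 1" using assms(1) by (simp add: cross_def)
  have "u $ 1 * (p $ 1 * p $ 1 + p $ 2 * p $ 2) = (p $ 1 * u $ 1 + p $ 2 * u $ 2) * p $ 1"
    using c by (simp add: algebra_simps)
  moreover have "u $ 2 * (p $ 1 * p $ 1 + p $ 2 * p $ 2) = (p $ 1 * u $ 1 + p $ 2 * u $ 2) * p $ 2"
    using c by (simp add: algebra_simps)
  ultimately show "u = ((p \<bullet> u) / (p \<bullet> p)) *\<^sub>R p"
    using N by (simp add: R2_eq_iff inner_R2 eq_divide_eq)
qed

lemma axis_quad_interior: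
  assumes "l > 0" "cross p u > 0" "cross p v < 0"
  shows "0 \<in> interior (convex hull {p, - (l *\<^sub>R p), u, v})"
  unfolding zero_in_interior_hull_iff
proof (intro allI impI)
  fix w :: R2 assume w: "w \<noteq> 0"
  have p: "p \<noteq> 0" using assms by (auto simp: cross_def)
  consider "w \<bullet> p < 0" | "w \<bullet> p > 0" | "w \<bullet> p = 0" by linarith
  then show "\<exists>y\<in>{p, - (l *\<^sub>R p), u, v}. w \<bullet> y < 0"
  proof cases
    case 3
    have "cross p w \<noteq> 0"
    proof
      assume "cross p w = 0"
      then have "(p \<bullet> p) * (w \<bullet> w) = 0" using 3 inner_cross_identity[of p w w] by (simp add: inner_commute)
      then show False using p w by simp
    qed
    moreover have "(p \<bullet> p) * (w \<bullet> u) = cross p w * cross p u" "(p \<bullet> p) * (w \<bullet> v) = cross p w * cross p v"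
      using 3 inner_cross_identity[of p w] by (auto simp: inner_commute)
    moreover have "p \<bullet> p > 0" using p by simp
    moreover have "cross p w * cross p v < 0" if "cross p w > 0"
      using that assms by (simp add: mult_less_0_iff)
    moreover have "cross p w * cross p u < 0" if "cross p w < 0"
      using that assms by (simp add: mult_less_0_iff)
    ultimately have "w \<bullet> u < 0 \<or> w \<bullet> v < 0"
      by (metis linorder_neqE_linordered_idom mult_less_cancel_left_pos mult_zero_right)
    then show ?thesis by auto
  qed (use assms in \<open>auto simp: mult_pos_pos\<close>)
qed

context covariant_valuation
begin

text \<open>A matrix of determinant 1 takes the horizontal axis to the line of \<open>p\<close>.
  That the segment from \<open>u\<close> to \<open>v\<close> meets this line at
  \<open>x *\<^sub>R p\<close>, between the two axis vertices, is the convex position demanded by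
  \<open>quad_dom\<close>.\<close>

lemma axis_quad_is_quad:
  assumes l: "l > 0" and u: "cross p u > 0" and v: "cross p v < 0"
    and k: "0 \<le> k" "k \<le> 1" and e: "(1 - k) *\<^sub>R u + k *\<^sub>R v = x *\<^sub>R p" and x: "- l \<le> x" "x \<le> 1"
  obtains A a b c t d s where "A \<in> VL2" "quad_dom a b c t d s"
    "convex hull {p, - (l *\<^sub>R p), u, v} = (*v) A ` quad a b c t d s"
proof -
  define N where "N = p \<bullet> p"
  have "p \<noteq> 0" using u by (auto simp: cross_def)
  then have N: "N > 0" by (simp add: N_def)
  have N': "p $ 1 * p $ 1 + p $ 2 * p $ 2 = N" by (simp add: N_def inner_R2)
  \<comment> \<open>The columns are \<open>p\<close> and its quarter turn divided by
    \<open>N\<close>, which makes the determinant 1.\<close>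
  define A where "A = mat2 (p $ 1) (- p $ 2 / N) (p $ 2) (p $ 1 / N)"
  have "det A = 1"
    using N N' by (simp add: A_def add_divide_distrib[symmetric])
  define t s where "t = cross p u" and "s = - cross p v"
  have ts: "t > 0" "s > 0" using u v by (auto simp: t_def s_def)
  define c d where "c = (p \<bullet> u / N) / t" and "d = (p \<bullet> v / N) / s"
  have A_img: "A *v pt (p \<bullet> y / N) (cross p y) = y" for y
  proof -
    have 1: "p $ 1 * (p \<bullet> y) - p $ 2 * cross p y = y $ 1 * N"
      "p $ 2 * (p \<bullet> y) + p $ 1 * cross p y = y $ 2 * N"
      unfolding N'[symmetric] by (auto simp: inner_R2 cross_def algebra_simps)
    have "(A *v pt (p \<bullet> y / N) (cross p y)) $ 1 = (p $ 1 * (p \<bullet> y) - p $ 2 * cross p y) / N"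
      "(A *v pt (p \<bullet> y / N) (cross p y)) $ 2 = (p $ 2 * (p \<bullet> y) + p $ 1 * cross p y) / N"
      by (auto simp: A_def mult_R2_nth diff_divide_distrib add_divide_distrib)
    then show ?thesis unfolding 1 R2_eq_iff using N by simp
  qed
  have Au: "A *v pt (c * t) t = u" using A_img[of u] ts by (simp add: c_def t_def)
  have Av: "A *v pt (d * s) (- s) = v" using A_img[of v] ts by (simp add: d_def s_def)
  have Ap: "A *v pt r 0 = r *\<^sub>R p" for r by (simp add: A_def R2_eq_iff)
  have hull: "convex hull {p, - (l *\<^sub>R p), u, v} = (*v) A ` quad l 1 c t d s"
    unfolding quad_def matrix_image_hull by (simp add: Au Av Ap)
  have "cross p ((1 - k) *\<^sub>R u + k *\<^sub>R v) = 0" using e by simp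
  then have kk: "(1 - k) * t = k * s" by (simp add: t_def s_def)
  have "p \<bullet> ((1 - k) *\<^sub>R u + k *\<^sub>R v) = x * N" using e by (simp add: N_def)
  then have "(1 - k) * (p \<bullet> u) + k * (p \<bullet> v) = x * N"
    by (simp only: inner_add_right inner_scaleR_right)
  then have "((1 - k) * (p \<bullet> u) + k * (p \<bullet> v)) / N = x" using N by simp
  then have "(1 - k) * (c * t) + k * (d * s) = x"
    using ts by (simp add: c_def d_def add_divide_distrib)
  moreover have "k = t / (s + t)" "1 - k = s / (s + t)" using kk ts by (auto simp: field_simps)
  ultimately have "s / (s + t) * (c * t) + t / (s + t) * (d * s) = x" by simp
  then have "(s * (c * t) + t * (d * s)) / (s + t) = x" by (simp add: add_divide_distrib)
  then have "s * t * (c + d) = x * (s + t)" using ts by (simp add: divide_eq_eq algebra_simps)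
  \<comment> \<open>For the diagonal from \<open>- l\<close> to 1, \<open>quad_dom\<close> bounds
    \<open>c + d\<close> by \<open>- l\<close> and 1 times \<open>1 / s + 1 / t\<close>, that is, it
    places \<open>x\<close> between \<open>- l\<close> and 1.\<close>
  then have cd: "c + d = x * (1 / s + 1 / t)" using ts by (simp add: field_simps)
  moreover have pos: "1 / s + 1 / t \<ge> 0" using ts by simp
  ultimately have "c + d \<le> 1 * (1 / s + 1 / t)" "- l * (1 / s + 1 / t) \<le> c + d"
    using mult_right_mono[OF x(1) pos] mult_right_mono[OF x(2) pos] by auto
  then have "quad_dom l 1 c t d s" using l ts by (auto simp: quad_dom_def algebra_simps)
  with hull \<open>det A = 1\<close> show thesis using that[of A] by (auto simp: VL2_def)
qed

text \<open>Covariance carries the zero over from \<open>quad\<close>; if \<open>u\<close> and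
  \<open>v\<close> lie on the opposite sides, they are exchanged and \<open>k\<close> becomes
  \<open>1 - k\<close>.\<close>

lemma axis_quad_vanishes:
  assumes zero: "\<And>a b c t d s. quad_dom a b c t d s \<Longrightarrow> F a b c t d s = 0"
    and l: "l > 0" and uv: "cross p u * cross p v < 0"
    and k: "0 \<le> k" "k \<le> 1" and e: "(1 - k) *\<^sub>R u + k *\<^sub>R v = x *\<^sub>R p" and x: "- l \<le> x" "x \<le> 1"
  shows "convex hull {p, - (l *\<^sub>R p), u, v} \<in> polygons_o" "nu (convex hull {p, - (l *\<^sub>R p), u, v}) = 0"
proof -
  have *: "convex hull {p, - (l *\<^sub>R p), u, v} \<in> polygons_o \<and> nu (convex hull {p, - (l *\<^sub>R p), u, v}) = 0"
    if uvk: "cross p u > 0" "cross p v < 0" "0 \<le> k" "k \<le> 1" "(1 - k) *\<^sub>R u + k *\<^sub>R v = x *\<^sub>R p" for u v k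
  proof -
    obtain A a b c t d s where A: "A \<in> VL2" and D: "quad_dom a b c t d s"
      and eq: "convex hull {p, - (l *\<^sub>R p), u, v} = (*v) A ` quad a b c t d s"
      using axis_quad_is_quad[OF l uvk x] by blast
    have "quad a b c t d s \<in> polygons_o" using D by (auto simp: quad_dom_def intro: quad_in_polygons_o)
    then show ?thesis
      using cov[OF A] mult_in_polygons_o[OF A] zero[OF D] unfolding eq by simp
  qed
  consider "cross p u > 0" "cross p v < 0" | "cross p u < 0" "cross p v > 0"
    using uv by (auto simp: mult_less_0_iff)
  then have "convex hull {p, - (l *\<^sub>R p), u, v} \<in> polygons_o \<and> nu (convex hull {p, - (l *\<^sub>R p), u, v}) = 0"
  proof cases
    case 2
    then show ?thesis using *[of v u "1 - k"] k e by (simp add: insert_commute add.commute)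
  qed (use * k e in blast)
  then show "convex hull {p, - (l *\<^sub>R p), u, v} \<in> polygons_o" "nu (convex hull {p, - (l *\<^sub>R p), u, v}) = 0"
    by auto
qed

section \<open>Cutting off vertices\<close>

text \<open>Every segment from \<open>c\<close> to a point of \<open>?A\<close> crosses the segment
  from \<open>x\<close> to \<open>y\<close> on the line \<open>l \<bullet> p = 1\<close>, so
  \<open>?P\<close> is \<open>?A\<close> with the triangle \<open>c, x, y\<close> attached. The
  point \<open>w\<close> brings the origin into the interior of the attached piece and of the
  intersection, and \<open>nu\<close> vanishes on both by \<open>axis_quad_vanishes\<close>.\<close>

lemma vanishes_on_reduction:
  assumes zero: "\<And>a b c t d s. quad_dom a b c t d s \<Longrightarrow> F a b c t d s = 0"
    and S: "finite S" "\<And>x. x \<in> S \<Longrightarrow> x extreme_point_of (convex hull S)"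
    and c: "c \<in> S" and A: "0 \<in> interior (convex hull (S - {c}))"
    and A0: "nu (convex hull (S - {c})) = 0"
  shows "nu (convex hull S) = 0"
proof -
  let ?P = "convex hull S" and ?A = "convex hull (S - {c})"
  have ins: "insert c (S - {c}) = S" using c by auto
  have c_notin: "c \<notin> ?A"
  proof
    assume "c \<in> ?A"
    then have "?P = ?A" using hull_redundant[of c convex "S - {c}"] ins by simp
    then show False using S(2)[OF c] extreme_point_of_convex_hull[of c "S - {c}"] by auto
  qed
  have AP: "?A \<subseteq> ?P" by (intro hull_mono) auto
  have "0 \<in> ?A" using A interior_subset by blast
  then have "c \<noteq> 0" using c_notin by auto
  obtain r x y l where r: "r > 0" and xy: "x \<in> S - {c}" "y \<in> S - {c}"
    and e: "r *\<^sub>R c \<in> closed_segment x y" and l: "\<And>p. p \<in> ?A \<Longrightarrow> l \<bullet> p \<le> 1"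
    and lxy: "l \<bullet> x = 1" "l \<bullet> y = 1"
    using polygon_facet_on_ray[OF _ A \<open>c \<noteq> 0\<close>] S(1) by (metis finite_Diff)
  have xyA: "x \<in> ?A" "y \<in> ?A" using xy by (auto intro: hull_inc)
  obtain k where k: "0 \<le> k" "k \<le> 1" "r *\<^sub>R c = (1 - k) *\<^sub>R x + k *\<^sub>R y"
    using e by (auto simp: in_segment)
  have le: "l \<bullet> (r *\<^sub>R c) = 1"
    unfolding k(3) inner_add_right inner_scaleR_right lxy by simp
  have eA: "r *\<^sub>R c \<in> ?A"
    using e closed_segment_subset[OF xyA convex_convex_hull] by blast
  have "r < 1"
  proof (rule ccontr)
    assume "\<not> r < 1"
    then have "c \<in> closed_segment 0 (r *\<^sub>R c)"
      by (auto simp: in_segment intro!: exI[of _ "1 / r"])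
    then show False
      using closed_segment_subset[OF \<open>0 \<in> ?A\<close> eA convex_convex_hull] c_notin by blast
  qed
  have lc: "l \<bullet> c > 1"
  proof -
    have "l \<bullet> c = 1 / r" using le r by (simp add: field_simps)
    then show ?thesis using r \<open>r < 1\<close> by simp
  qed
  have ray_ext: "r *\<^sub>R c \<noteq> q" if "q \<in> S - {c}" for q
  proof
    assume "r *\<^sub>R c = q"
    then have "q \<in> open_segment 0 c"
      using r \<open>r < 1\<close> \<open>c \<noteq> 0\<close> by (auto simp: in_segment intro!: exI[of _ r])
    moreover have "q extreme_point_of ?P" "0 \<in> ?P" "c \<in> ?P"
      using that S(2) c \<open>0 \<in> ?A\<close> AP by (auto intro: hull_inc)
    ultimately show False by (auto simp: extreme_point_of_def)
  qed
  have "x \<noteq> y" using e ray_ext[OF xy(1)] by auto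
  \<comment> \<open>Beyond \<open>x\<close> or \<open>y\<close> the line leaves \<open>?P\<close>,
    since otherwise one of these extreme points would lie inside a segment of
    \<open>?P\<close>.\<close>
  have on_line: "f \<in> closed_segment x y" if f: "f \<in> ?P" "l \<bullet> f = 1" for f
  proof -
    have "l \<noteq> 0" using lc by auto
    have "aff_dim {f, x, y} \<le> aff_dim {p. l \<bullet> p = 1}"
      using f lxy by (intro aff_dim_subset) auto
    also have "\<dots> = 1" using \<open>l \<noteq> 0\<close> by (simp add: aff_dim_hyperplane)
    finally have "collinear {f, x, y}" by (simp add: collinear_aff_dim)
    moreover have "x extreme_point_of ?P" "y extreme_point_of ?P" "x \<in> ?P" "y \<in> ?P"
      using xy S(2) by (auto intro: hull_inc)
    then have "x \<notin> open_segment y f" "y \<notin> open_segment f x"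
      using f by (auto simp: extreme_point_of_def)
    ultimately show ?thesis
      using \<open>x \<noteq> y\<close> by (auto simp: collinear_between_cases between_mem_segment open_segment_def)
  qed
  obtain h where h: "h > 0" "- (h *\<^sub>R c) \<in> ?A"
  proof -
    obtain d where d: "d > 0" "cball 0 d \<subseteq> ?A" using A by (meson mem_interior_cball)
    then have "- ((d / norm c) *\<^sub>R c) \<in> ?A" using \<open>c \<noteq> 0\<close> by (auto simp: subset_iff)
    then show thesis using that[of "d / norm c"] d \<open>c \<noteq> 0\<close> by auto
  qed
  define w where "w = - (h *\<^sub>R c)"
  let ?D = "convex hull {x, y, w}" and ?B = "convex hull {c, x, y, w}"
  have DA: "?D \<subseteq> ?A" using xyA h by (intro hull_minimal) (auto simp: w_def)
  have DB: "?D \<subseteq> ?B" by (intro hull_mono) auto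
  have BP: "?B \<subseteq> ?P"
    using xyA h AP c by (intro hull_minimal) (auto simp: w_def hull_inc)
  have cP: "c \<in> ?P" using c by (rule hull_inc)
  have crossing_in: "f \<in> closed_segment x y" if "f \<in> closed_segment c b" "l \<bullet> f = 1" "b \<in> ?A" for f b
  proof (rule on_line)
    show "f \<in> ?P" using closed_segment_subset[OF cP _ convex_convex_hull, of b] that AP by blast
  qed fact
  have segD: "closed_segment x y \<subseteq> ?D" "closed_segment x y \<subseteq> ?A"
    by (intro closed_segment_subset; auto simp: hull_inc xyA)+
  have union: "?A \<union> ?B = ?P"
  proof (intro equalityI subsetI)
    fix z assume "z \<in> ?P"
    then have "z \<in> convex hull (insert c (S - {c}))" by (simp only: ins)
    then obtain b where b: "b \<in> ?A" "z \<in> closed_segment c b"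
      using convex_hull_insert_segment[of z c "S - {c}"] xy by blast
    obtain f where f: "f \<in> closed_segment c b" "l \<bullet> f = 1"
      "l \<bullet> z \<le> 1 \<Longrightarrow> z \<in> closed_segment f b" "l \<bullet> z \<ge> 1 \<Longrightarrow> z \<in> closed_segment c f"
      using segment_crossing[OF b(2) lc l[OF b(1)]] by blast
    have fs: "f \<in> closed_segment x y" using crossing_in f b by blast
    show "z \<in> ?A \<union> ?B"
    proof (cases "l \<bullet> z \<le> 1")
      case True
      then show ?thesis
        using f(3) closed_segment_subset[of f ?A b] fs segD b by (auto simp: subset_iff)
    next
      case False
      then have "z \<in> closed_segment c f" using f(4) by simp
      moreover have "c \<in> ?B" "f \<in> ?B" using fs segD DB by (auto simp: hull_inc)
      ultimately show ?thesis using closed_segment_subset[of c ?B f] by auto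
    qed
  qed (use AP BP in auto)
  have inter: "?A \<inter> ?B = ?D"
  proof (intro equalityI subsetI)
    fix z assume z: "z \<in> ?A \<inter> ?B"
    then obtain b where b: "b \<in> ?D" "z \<in> closed_segment c b"
      using convex_hull_insert_segment[of z c "{x, y, w}"] by auto
    have bA: "b \<in> ?A" using b DA by blast
    obtain f where f: "f \<in> closed_segment c b" "l \<bullet> f = 1" "l \<bullet> z \<le> 1 \<Longrightarrow> z \<in> closed_segment f b"
      using segment_crossing[OF b(2) lc l[OF bA]] by blast
    have "f \<in> ?D" using crossing_in[OF f(1,2) bA] segD by blast
    moreover have "z \<in> closed_segment f b" using f(3) l z by blast
    ultimately show "z \<in> ?D"
      using closed_segment_subset[of f ?D b] b by auto
  qed (use DA DB in auto)
  have "cross c (r *\<^sub>R c) = 0" by simp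
  then have cr: "(1 - k) * cross c x + k * cross c y = 0" unfolding k(3) by simp
  have cross_ne: "cross c q \<noteq> 0" if q: "q \<in> S - {c}" "l \<bullet> q = 1" for q
  proof
    assume "cross c q = 0"
    then obtain r' where r': "q = r' *\<^sub>R c" using cross_eq_0_imp_scaleR \<open>c \<noteq> 0\<close> by blast
    then have "r' * (l \<bullet> c) = r * (l \<bullet> c)" using q le by simp
    then show False using ray_ext[OF q(1)] r' lc by auto
  qed
  have k01: "k \<noteq> 0" "k \<noteq> 1"
    using k(3) ray_ext[OF xy(1)] ray_ext[OF xy(2)] by auto
  have opp: "cross c x * cross c y < 0"
  proof -
    have "(1 - k) * (cross c x * cross c x) + k * (cross c x * cross c y) = 0"
      using arg_cong[OF cr, of "\<lambda>u. cross c x * u"] by (simp add: algebra_simps)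
    moreover have "(1 - k) * (cross c x * cross c x) > 0"
    proof (rule mult_pos_pos)
      show "0 < cross c x * cross c x"
        using cross_ne[OF xy(1) lxy(1)] not_real_square_gt_zero by blast
    qed (use k k01 in simp)
    ultimately have "k * (cross c x * cross c y) < 0" by linarith
    then show ?thesis using k by (simp add: mult_less_0_iff)
  qed
  have B: "?B \<in> polygons_o" "nu ?B = 0"
    using axis_quad_vanishes[OF zero h(1) opp k(1,2) k(3)[symmetric]] r \<open>r < 1\<close> h
    by (simp_all add: w_def insert_commute)
  \<comment> \<open>The triangle is a degenerate quadrilateral with axis \<open>w\<close>: its
    fourth vertex \<open>- ((r / h) *\<^sub>R w)\<close> equals \<open>r *\<^sub>R c\<close> and
    lies on the side from \<open>x\<close> to \<open>y\<close>.\<close>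
  have D: "?D \<in> polygons_o" "nu ?D = 0"
  proof -
    have wc: "r *\<^sub>R c = (- (r / h)) *\<^sub>R w" using h by (simp add: w_def)
    have "cross w q = - h * cross c q" for q by (simp add: w_def cross_def algebra_simps)
    then have "cross w x * cross w y = h\<^sup>2 * (cross c x * cross c y)" by (simp add: power2_eq_square)
    then have opp': "cross w x * cross w y < 0" using opp h by (simp add: mult_less_0_iff)
    have "(1 - k) *\<^sub>R x + k *\<^sub>R y = (- (r / h)) *\<^sub>R w" using k(3) wc by simp
    note ax = axis_quad_vanishes[OF zero _ opp' k(1,2) this, of "r / h"]
    have "- ((r / h) *\<^sub>R w) \<in> convex hull {w, x, y}"
    proof -
      have "closed_segment x y \<subseteq> convex hull {w, x, y}"
        by (intro closed_segment_subset) (auto simp: hull_inc)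
      then show ?thesis using e wc by auto
    qed
    then have "convex hull {w, - ((r / h) *\<^sub>R w), x, y} = ?D"
      using hull_redundant[of "- ((r / h) *\<^sub>R w)" convex "{w, x, y}"]
      by (simp add: insert_commute)
    moreover have "r / h > 0" using r h by simp
    ultimately show "?D \<in> polygons_o" "nu ?D = 0" using ax by auto
  qed
  have "?A \<in> polygons_o" using S(1) A by (intro hull_in_polygons_o) auto
  moreover have "0 \<in> interior ?P" using A AP interior_mono by blast
  then have "?P \<in> polygons_o" using S(1) by (intro hull_in_polygons_o)
  ultimately have "nu ?P + nu ?D = nu ?A + nu ?B"
    using val[unfolded is_valuation_on_def, rule_format, of ?A ?B] union inter B D by simp
  then show ?thesis using B D A0 by simp
qed

text \<open>Induction on the number of generating points. Either some vertex can be cut off with the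
  origin staying interior, or the polygon is a triangle or a quadrilateral with a diagonal through
  the origin.\<close>

lemma vanishes_on_polygons:
  assumes zero: "\<And>a b c t d s. quad_dom a b c t d s \<Longrightarrow> F a b c t d s = 0"
    and P: "P \<in> polygons_o"
  shows "nu P = 0"
proof -
  have "nu (convex hull S) = 0" if "finite S" "0 \<in> interior (convex hull S)" for S
    using that
  proof (induction "card S" arbitrary: S rule: less_induct)
    case less
    define S0 where "S0 = {x. x extreme_point_of (convex hull S)}"
    have S0S: "S0 \<subseteq> S" unfolding S0_def by (rule extreme_points_of_convex_hull)
    have fin: "finite S0" using S0S less.prems(1) finite_subset by blast
    have hull: "convex hull S0 = convex hull S"
      unfolding S0_def by (rule Krein_Milman_polytope[OF less.prems(1), symmetric])
    have ext: "x extreme_point_of (convex hull S0)" if "x \<in> S0" for x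
    proof -
      have "x extreme_point_of (convex hull S)" using that by (simp add: S0_def)
      then show ?thesis by (simp only: hull)
    qed
    have int: "0 \<in> interior (convex hull S0)" using less.prems hull by simp
    have reduce: "nu (convex hull S0) = 0" if c: "c \<in> S0" and c_int: "0 \<in> interior (convex hull (S0 - {c}))" for c
    proof -
      have "card (S0 - {c}) < card S"
        using c S0S less.prems(1) by (intro psubset_card_mono) auto
      then have "nu (convex hull (S0 - {c})) = 0"
        using less.hyps[of "S0 - {c}"] fin c_int by simp
      then show ?thesis using vanishes_on_reduction[OF zero fin ext c c_int] by blast
    qed
    \<comment> \<open>It suffices to find a few vertices \<open>T\<close> whose hull has the origin
      in its interior: any further vertex can be cut off, and only \<open>S0 = T\<close> remains to
      be treated.\<close>
    have core: "nu (convex hull S0) = 0"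
      if T: "T \<subseteq> S0" "0 \<in> interior (convex hull T)" and T0: "S0 = T \<Longrightarrow> nu (convex hull T) = 0" for T
    proof (cases "S0 = T")
      case False
      then obtain c where c: "c \<in> S0" "c \<notin> T" using T by blast
      then have "convex hull T \<subseteq> convex hull (S0 - {c})" using T by (intro hull_mono) auto
      then show ?thesis using reduce[OF c(1)] T(2) interior_mono by blast
    qed (use T0 in simp)
    have "0 \<in> convex hull S0" using int interior_subset by blast
    then obtain p where p: "p \<in> S0" by fastforce
    have "p \<noteq> 0" using ext[OF p] int extreme_point_not_in_interior by blast
    then obtain r x y l where r: "r > 0" and xy: "x \<in> S0" "y \<in> S0"
      and e: "r *\<^sub>R (- p) \<in> closed_segment x y" and lxy: "l \<bullet> x = 1" "l \<bullet> y = 1"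
      using polygon_facet_on_ray[OF fin int, of "- p"] by (metis neg_equal_0_iff_equal)
    obtain k where k: "0 \<le> k" "k \<le> 1" "(1 - k) *\<^sub>R x + k *\<^sub>R y = (- r) *\<^sub>R p"
      using e by (auto simp: in_segment)
    have "l \<bullet> ((1 - k) *\<^sub>R x + k *\<^sub>R y) = 1"
      unfolding inner_add_right inner_scaleR_right lxy by simp
    then have le: "l \<bullet> p * r = - 1" unfolding k(3) by (simp add: mult.commute)
    \<comment> \<open>The ray opposite to the vertex \<open>p\<close> leaves the polygon at a vertex
      or inside an edge. In the first case \<open>T\<close> consists of both vertices and one more
      on each side of the line; in the second it is \<open>p\<close> with the endpoints of the
      edge.\<close>
    have "nu (convex hull S0) = 0"
    proof (cases "- (r *\<^sub>R p) = x \<or> - (r *\<^sub>R p) = y")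
      case True
      then have q: "- (r *\<^sub>R p) \<in> S0" using xy by auto
      have rot: "cross p w = pt (- p $ 2) (p $ 1) \<bullet> w" for w by (simp add: inner_R2 cross_def)
      have "pt (- p $ 2) (p $ 1) \<noteq> 0" using \<open>p \<noteq> 0\<close> by (auto simp: R2_eq_iff)
      then obtain v where v: "v \<in> S0" "cross p v < 0"
        using int unfolding zero_in_interior_hull_iff rot by blast
      have "- pt (- p $ 2) (p $ 1) \<noteq> 0" using \<open>p \<noteq> 0\<close> by (auto simp: R2_eq_iff)
      then obtain u where "u \<in> S0" "- pt (- p $ 2) (p $ 1) \<bullet> u < 0"
        using int unfolding zero_in_interior_hull_iff by blast
      then have u: "u \<in> S0" "cross p u > 0" by (auto simp: rot)
      show ?thesis
      proof (rule core)
        show "{p, - (r *\<^sub>R p), u, v} \<subseteq> S0" using p q u v by auto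
        show "0 \<in> interior (convex hull {p, - (r *\<^sub>R p), u, v})"
          by (rule axis_quad_interior[OF r u(2) v(2)])
        assume S0: "S0 = {p, - (r *\<^sub>R p), u, v}"
        \<comment> \<open>This is the parameter at which the segment from \<open>u\<close> to
          \<open>v\<close> crosses the line of \<open>p\<close>.\<close>
        define m where "m = cross p u / (cross p u - cross p v)"
        have m: "0 \<le> m" "m \<le> 1" using u v by (auto simp: m_def)
        have "(1 - m) * (cross p u - cross p v) = - cross p v" "m * (cross p u - cross p v) = cross p u"
          using u v by (auto simp: m_def field_simps)
        then have "((1 - m) * cross p u + m * cross p v) * (cross p u - cross p v) = 0"
          by (simp add: algebra_simps)
        then have "cross p ((1 - m) *\<^sub>R u + m *\<^sub>R v) = 0" using u v by simp
        then obtain x' where x': "(1 - m) *\<^sub>R u + m *\<^sub>R v = x' *\<^sub>R p"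
          using cross_eq_0_imp_scaleR \<open>p \<noteq> 0\<close> by blast
        have "(1 - m) *\<^sub>R u + m *\<^sub>R v \<in> closed_segment u v" using m by (auto simp: in_segment)
        then have e'P: "x' *\<^sub>R p \<in> convex hull S0"
          using closed_segment_subset[of u "convex hull S0" v] u v x' by (auto simp: hull_inc)
        \<comment> \<open>An extreme point cannot lie strictly between 0 and
          \<open>x' *\<^sub>R p\<close>. Applied to \<open>p\<close> and to
          \<open>- (r *\<^sub>R p)\<close>, this keeps \<open>x'\<close> between \<open>- r\<close>
          and 1.\<close>
        have not_beyond: False
          if "u' *\<^sub>R (x' *\<^sub>R p) \<in> S0" "0 < u'" "u' < 1" "x' \<noteq> 0" for u'
        proof -
          have "u' *\<^sub>R (x' *\<^sub>R p) \<in> open_segment 0 (x' *\<^sub>R p)"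
            using that(2-4) \<open>p \<noteq> 0\<close> by (auto simp: in_segment intro!: exI[of _ u'])
          then show False
            using ext[OF that(1)] e'P \<open>0 \<in> convex hull S0\<close> by (auto simp: extreme_point_of_def)
        qed
        have "x' \<le> 1"
        proof (rule ccontr)
          assume "\<not> x' \<le> 1"
          then show False using not_beyond[of "1 / x'"] p by simp
        qed
        moreover have "- r \<le> x'"
        proof (rule ccontr)
          assume "\<not> - r \<le> x'"
          then show False using not_beyond[of "- r / x'"] q r by (simp add: field_simps)
        qed
        moreover have "cross p u * cross p v < 0" using u v by (simp add: mult_less_0_iff)
        ultimately show "nu (convex hull {p, - (r *\<^sub>R p), u, v}) = 0"
          using axis_quad_vanishes(2)[OF zero r _ m x'] by blast
      qed
    next
      case False
      have ne: "cross p q \<noteq> 0" if "l \<bullet> q = 1" "- (r *\<^sub>R p) \<noteq> q" for q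
      proof
        assume "cross p q = 0"
        then obtain r' where r': "q = r' *\<^sub>R p" using cross_eq_0_imp_scaleR \<open>p \<noteq> 0\<close> by blast
        then have "r' * (l \<bullet> p) = - r * (l \<bullet> p)" using that le by (simp add: mult.commute)
        moreover have "l \<bullet> p \<noteq> 0" using le by auto
        ultimately have "r' = - r" by (metis mult_right_cancel)
        then show False using r' that by simp
      qed
      have k01: "k \<noteq> 0" "k \<noteq> 1" using k(3) False by auto
      have "cross p ((1 - k) *\<^sub>R x + k *\<^sub>R y) = 0" unfolding k(3) by simp
      then have cr: "(1 - k) * cross p x + k * cross p y = 0" by simp
      have "(1 - k) * (cross p x * cross p x) + k * (cross p x * cross p y) = 0"
        using arg_cong[OF cr, of "\<lambda>u. cross p x * u"] by (simp add: algebra_simps)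
      moreover have "(1 - k) * (cross p x * cross p x) > 0"
      proof (rule mult_pos_pos)
        show "0 < cross p x * cross p x"
          using ne[OF lxy(1)] False not_real_square_gt_zero by blast
      qed (use k k01 in simp)
      ultimately have "k * (cross p x * cross p y) < 0" by linarith
      then have opp: "cross p x * cross p y < 0" using k by (simp add: mult_less_0_iff)
      have "- (r *\<^sub>R p) \<in> convex hull {p, x, y}"
      proof -
        have "closed_segment x y \<subseteq> convex hull {p, x, y}"
          by (intro closed_segment_subset) (auto simp: hull_inc)
        then show ?thesis using e by auto
      qed
      then have tri: "convex hull {p, - (r *\<^sub>R p), x, y} = convex hull {p, x, y}"
        using hull_redundant[of "- (r *\<^sub>R p)" convex "{p, x, y}"] by (simp add: insert_commute)
      note ax = axis_quad_vanishes[OF zero r opp k(1,2,3), unfolded tri]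
      show ?thesis
        by (rule core[of "{p, x, y}"]) (use p xy ax r in \<open>auto simp: polygons_o_def\<close>)
    qed
    then show ?case by (simp add: hull)
  qed
  then show ?thesis using P by (auto simp: polygons_o_def)
qed

end

section \<open>The moment vector\<close>

lemma polygons_o_props:
  assumes "P \<in> polygons_o"
  shows "compact P" "convex P" "0 \<in> interior P" "0 \<in> P"
  using assms interior_subset by (auto simp: polygons_o_def finite_imp_compact_convex_hull)

lemma id_absolutely_integrable:
  fixes P :: "R2 set"
  assumes "compact P"
  shows "(\<lambda>x. x) absolutely_integrable_on P"
proof -
  have "integrable lborel (\<lambda>x. indicator P x *\<^sub>R x)"
    using assms by (intro borel_integrable_compact) auto
  then show ?thesis
    unfolding set_integrable_def by (intro integrable_completion[THEN iffD2]) auto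
qed

lemma moment_valuation: "is_valuation_on polygons_o moment"
  unfolding is_valuation_on_def
proof (intro allI impI)
  fix K L :: "R2 set"
  assume KL: "K \<in> polygons_o \<and> L \<in> polygons_o \<and> K \<union> L \<in> polygons_o \<and> K \<inter> L \<in> polygons_o"
  let ?g = "\<lambda>S x. if x \<in> S then x else (0::R2)"
  have int: "?g S integrable_on UNIV" and mom: "moment S = integral UNIV (?g S)" if "S \<in> polygons_o" for S
  proof -
    have "(\<lambda>x. x) integrable_on S"
      using id_absolutely_integrable polygons_o_props(1)[OF that] set_lebesgue_integral_eq_integral(1) by blast
    then show "?g S integrable_on UNIV" by (simp add: integrable_restrict_UNIV)
    show "moment S = integral UNIV (?g S)" by (simp add: moment_def integral_restrict_UNIV)
  qed
  have eq: "(\<lambda>x. ?g (K \<union> L) x + ?g (K \<inter> L) x) = (\<lambda>x. ?g K x + ?g L x)" by auto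
  have add: "moment S + moment T = integral UNIV (\<lambda>x. ?g S x + ?g T x)"
    if "S \<in> polygons_o" "T \<in> polygons_o" for S T
    unfolding mom[OF that(1)] mom[OF that(2)] using that by (intro integral_add[symmetric] int)
  have KL': "K \<in> polygons_o" "L \<in> polygons_o" "K \<union> L \<in> polygons_o" "K \<inter> L \<in> polygons_o"
    using KL by auto
  show "moment (K \<union> L) + moment (K \<inter> L) = moment K + moment L"
    unfolding add[OF KL'(1,2)] add[OF KL'(3,4)] eq ..
qed

lemma moment_covariant:
  assumes A: "A \<in> VL2" and P: "P \<in> polygons_o"
  shows "moment ((*v) A ` P) = A *v moment P"
proof -
  have "compact ((*v) A ` P)"
    using polygons_o_props(1)[OF P] by (intro compact_continuous_image) (auto intro: continuous_intros)
  then have "(\<lambda>x. x) absolutely_integrable_on ((*v) A ` P)" by (rule id_absolutely_integrable)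
  then have "integral ((*v) A ` P) (\<lambda>x. x) = \<bar>det (matrix ((*v) A))\<bar> *\<^sub>R integral P ((\<lambda>x. x) \<circ> (*v) A)"
    by (intro integral_change_of_variables_linear) auto
  moreover have "\<bar>det A\<bar> = 1" using A by (auto simp: VL2_def)
  moreover have "integral P ((*v) A \<circ> (\<lambda>x. x)) = A *v integral P (\<lambda>x. x)"
    using id_absolutely_integrable[OF polygons_o_props(1)[OF P]] set_lebesgue_integral_eq_integral(1)
    by (intro integral_linear) (auto intro: matrix_vector_mul_bounded_linear)
  ultimately show ?thesis by (simp add: moment_def o_def)
qed

lemma norm_pt_le: "norm (pt x y) \<le> \<bar>x\<bar> + \<bar>y\<bar>"
  using norm_le_l1_cart[of "pt x y"] by (simp add: sum_2)

text \<open>The bound depends on \<open>R\<close> alone, hence is uniform over bounded families of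
  quadrilaterals; this gives the regularity condition.\<close>

lemma norm_moment_le:
  assumes "compact P" "P \<subseteq> cball 0 R"
  shows "norm (moment P) \<le> integral (cball 0 R) (\<lambda>x::R2. R)"
proof -
  let ?g = "\<lambda>x. if x \<in> P then x else (0::R2)"
  have "cball 0 R \<inter> P = P" using assms(2) by auto
  then have eq: "moment P = integral (cball 0 R) ?g"
    using integral_restrict_Int[of "cball 0 R" P "\<lambda>x. x"] by (simp add: moment_def Int_commute)
  have int: "(\<lambda>x. x) integrable_on P"
    using id_absolutely_integrable[OF assms(1)] set_lebesgue_integral_eq_integral(1) by blast
  show ?thesis
    unfolding eq
  proof (rule integral_norm_bound_integral)
    show "?g integrable_on cball 0 R"
      using int \<open>cball 0 R \<inter> P = P\<close> integrable_restrict_Int[of P "\<lambda>x. x" "cball 0 R"] by (simp add: Int_commute)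
    show "(\<lambda>x::R2. R) integrable_on cball 0 R" by (intro integrable_on_const) simp
    show "norm (?g x) \<le> R" if "x \<in> cball 0 R" for x
    proof -
      have "norm x \<le> R" using that by simp
      then show ?thesis using order_trans[OF norm_ge_zero] by auto
    qed
  qed
qed

interpretation moment: regular_covariant_valuation moment
proof
  fix a b t s :: real assume pos: "a > 0" "b > 0" "t > 0" "s > 0"
  define R where "R = a + b + 2 * t + s"
  have sub: "quad a b c t 0 s \<subseteq> cball 0 R" if "c \<in> {-1..1}" for c
    unfolding quad_def
  proof (rule hull_minimal)
    have "\<bar>c * t\<bar> \<le> t" using that pos by (auto simp: abs_mult intro!: mult_left_le_one_le)
    then show "{pt b 0, pt (- a) 0, pt (c * t) t, pt (0 * s) (- s)} \<subseteq> cball 0 R"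
      using pos norm_pt_le[of b 0] norm_pt_le[of "- a" 0] norm_pt_le[of "c * t" t] norm_pt_le[of 0 "- s"]
      by (auto simp: R_def)
  qed simp
  have "norm (moment (quad a b c t 0 s) $ 1) \<le> integral (cball 0 R) (\<lambda>x::R2. R)" if "c \<in> {-1..1}" for c
  proof -
    have "compact (quad a b c t 0 s)" using quad_in_polygons_o[OF pos] polygons_o_props(1) by blast
    from norm_moment_le[OF this sub[OF that]] show ?thesis
      using component_le_norm_cart[of "moment (quad a b c t 0 s)" 1] by simp
  qed
  then have "bounded ((\<lambda>c. moment (quad a b c t 0 s) $ 1) ` {-1..1})"
    unfolding bounded_iff by blast
  then show "\<exists>A\<in>sets lebesgue. A \<subseteq> {-1..1} \<and> emeasure lebesgue A > 0 \<and>
      bounded ((\<lambda>c. moment (quad a b c t 0 s) $ 1) ` A)"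
    by (intro bexI[of _ "{-1..1}"]) auto
qed (use moment_valuation moment_covariant in auto)

lemma cbox_in_polygons_o:
  assumes "0 \<in> box a (b::R2)"
  shows "cbox a b \<in> polygons_o"
proof -
  obtain S where "finite S" "cbox a b = convex hull S"
    using polytope_interval[of a b] by (auto simp: polytope_def)
  moreover have "0 \<in> interior (cbox a b)" using assms by (simp add: interior_cbox)
  ultimately show ?thesis unfolding polygons_o_def by blast
qed

text \<open>The box consists of a centrally symmetric square, which contributes 0 by covariance
  under \<open>-1\<close>, and a rectangle on which the first coordinate is at least 1.\<close>

lemma moment_nonzero: "\<exists>P\<in>polygons_o. moment P \<noteq> 0"
proof
  let ?f = "\<lambda>x::R2. x $ 1"
  let ?P = "cbox (pt (-1) (-1)) (pt 2 1)" and ?B = "cbox (pt (-1) (-1)) (pt 1 1)" and ?R = "cbox (pt 1 (-1)) (pt 2 1)"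
  show P: "?P \<in> polygons_o" by (intro cbox_in_polygons_o) (simp add: mem_box_cart forall_2)
  have B: "?B \<in> polygons_o" by (intro cbox_in_polygons_o) (simp add: mem_box_cart forall_2)
  have comp: "moment S $ 1 = integral S ?f" if "compact S" for S
  proof -
    have "(\<lambda>x. x) integrable_on S"
      using id_absolutely_integrable[OF that] set_lebesgue_integral_eq_integral(1) by blast
    then show ?thesis by (simp add: moment_def integral_component_eq_cart)
  qed
  have int: "?f integrable_on cbox u v" for u v by (intro integrable_continuous continuous_intros)
  have img: "(*v) (mat2 (-1) 0 0 (-1)) ` ?B = ?B"
  proof -
    have inv: "mat2 (-1) 0 0 (-1) *v x = - x" for x by (simp add: R2_eq_iff mult_R2_nth)
    show ?thesis
      unfolding inv by (auto simp: mem_box_cart forall_2 image_iff intro!: bexI[of _ "- _"])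
  qed
  have "moment ?B = mat2 (-1) 0 0 (-1) *v moment ?B"
    using moment_covariant[of "mat2 (-1) 0 0 (-1)" ?B] B img by (simp add: VL2_def)
  then have "moment ?B $ 1 = - (moment ?B $ 1)" by (metis mult_R2_nth mat2_nth mult_minus1 mult_zero_left add_0_right)
  then have B0: "integral ?B ?f = 0" using comp[of ?B] by simp
  have "negligible (?B \<inter> ?R)"
  proof (rule negligible_subset)
    show "negligible {x::R2. x $ 1 = 1}" 
      using negligible_hyperplane[of "pt 1 0" 1] by (simp add: inner_R2)
  qed (auto simp: mem_box_cart forall_2)
  then have "integral (?B \<union> ?R) ?f = integral ?B ?f + integral ?R ?f"
    by (intro integral_Un int)
  moreover have "?B \<union> ?R = ?P" by (auto simp: mem_box_cart forall_2)
  moreover have "integral ?R (\<lambda>x. 1) \<le> integral ?R ?f"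
    by (intro integral_le int) (auto simp: mem_box_cart forall_2)
  moreover have "integral ?R (\<lambda>x. 1::real) > 0"
  proof -
    have "\<forall>i. pt 1 (-1) $ i < pt 2 1 $ i" by (simp add: forall_2)
    then have "\<forall>i\<in>Basis. pt 1 (-1) \<bullet> i < pt 2 1 \<bullet> i" by (auto simp: Basis_vec_def inner_axis)
    then show ?thesis by (simp add: content_pos_lt_eq)
  qed
  ultimately have "moment ?P $ 1 > 0" using B0 comp[of ?P] by simp
  then show "moment ?P \<noteq> 0" by auto
qed

lemma covariant_valuation_diff:
  assumes "covariant_valuation f" "covariant_valuation g"
  shows "covariant_valuation (\<lambda>P. f P - k *\<^sub>R g P)"
proof
  interpret f: covariant_valuation f by fact
  interpret g: covariant_valuation g by fact
  show "is_valuation_on polygons_o (\<lambda>P. f P - k *\<^sub>R g P)"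
    unfolding is_valuation_on_def
  proof (intro allI impI)
    fix K L :: "R2 set"
    assume KL: "K \<in> polygons_o \<and> L \<in> polygons_o \<and> K \<union> L \<in> polygons_o \<and> K \<inter> L \<in> polygons_o"
    have "f (K \<union> L) + f (K \<inter> L) = f K + f L" "g (K \<union> L) + g (K \<inter> L) = g K + g L"
      using f.val g.val KL by (auto simp: is_valuation_on_def)
    then have "(f (K \<union> L) + f (K \<inter> L)) - k *\<^sub>R (g (K \<union> L) + g (K \<inter> L)) = (f K + f L) - k *\<^sub>R (g K + g L)"
      by simp
    then show "(f (K \<union> L) - k *\<^sub>R g (K \<union> L)) + (f (K \<inter> L) - k *\<^sub>R g (K \<inter> L))
        = (f K - k *\<^sub>R g K) + (f L - k *\<^sub>R g L)"
      by (simp add: scaleR_add_right algebra_simps)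
  qed
  show "f ((*v) A ` P) - k *\<^sub>R g ((*v) A ` P) = A *v (f P - k *\<^sub>R g P)"
    if "A \<in> VL2" "P \<in> polygons_o" for A P
    using f.cov[OF that] g.cov[OF that]
    by (simp add: matrix_vector_mult_diff_distrib matrix_vector_mult_scaleR)
qed

text \<open>On quadrilaterals \<open>nu\<close> and the moment are multiples \<open>C\<close> and
  \<open>M\<close> of the same expression. \<open>M = 0\<close> would make the moment vanish on all
  polygons, so \<open>C / M\<close> is the factor, and the difference vanishes everywhere by
  reduction.\<close>

theorem regular_covariant_valuation_eq_moment:
  assumes "regular_covariant_valuation nu"
  obtains k where "\<And>P. P \<in> polygons_o \<Longrightarrow> nu P = k *\<^sub>R moment P"
proof -
  interpret nu: regular_covariant_valuation nu by fact
  obtain C where C: "\<And>a b c t d s. quad_dom a b c t d s \<Longrightarrow> nu (quad a b c t d s)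
      = C *\<^sub>R pt ((b\<^sup>2 - a\<^sup>2) * (s + t) + (a + b) * (c * t\<^sup>2 + d * s\<^sup>2)) ((a + b) * (t\<^sup>2 - s\<^sup>2))"
    using nu.F_eq by blast
  obtain M where M: "\<And>a b c t d s. quad_dom a b c t d s \<Longrightarrow> moment (quad a b c t d s)
      = M *\<^sub>R pt ((b\<^sup>2 - a\<^sup>2) * (s + t) + (a + b) * (c * t\<^sup>2 + d * s\<^sup>2)) ((a + b) * (t\<^sup>2 - s\<^sup>2))"
    using moment.F_eq by blast
  have "M \<noteq> 0"
  proof
    assume "M = 0"
    then have "moment P = 0" if "P \<in> polygons_o" for P
      using moment.vanishes_on_polygons[OF _ that] M by simp
    then show False using moment_nonzero by blast
  qed
  interpret diff: covariant_valuation "\<lambda>P. nu P - (C / M) *\<^sub>R moment P"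
    by (intro covariant_valuation_diff nu.covariant_valuation_axioms moment.covariant_valuation_axioms)
  have "nu P - (C / M) *\<^sub>R moment P = 0" if "P \<in> polygons_o" for P
    by (rule diff.vanishes_on_polygons[OF _ that]) (use C M \<open>M \<noteq> 0\<close> in simp)
  then show thesis using that[of "C / M"] by simp
qed

section \<open>Polarity\<close>

lemma polar_convex_hull: "polar (convex hull S) = (\<Inter>x\<in>S. {y. x \<bullet> y \<le> 1})"
proof (intro equalityI subsetI)
  fix y assume "y \<in> (\<Inter>x\<in>S. {y. x \<bullet> y \<le> 1})"
  then have "convex hull S \<subseteq> {x. y \<bullet> x \<le> 1}"
    by (intro hull_minimal convex_halfspace_le) (auto simp: inner_commute)
  then show "y \<in> polar (convex hull S)" by (auto simp: polar_def)
qed (auto simp: polar_def inner_commute hull_inc)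

lemma polar_subset_cball:
  assumes "cball 0 e \<subseteq> P" "e > 0"
  shows "polar P \<subseteq> cball 0 (1 / e)"
proof
  fix y assume y: "y \<in> polar P"
  show "y \<in> cball 0 (1 / e)"
  proof (cases "y = 0")
    case False
    then have "(e / norm y) *\<^sub>R y \<in> P" using assms by (auto simp: subset_iff)
    then have "y \<bullet> ((e / norm y) *\<^sub>R y) \<le> 1" using y by (auto simp: polar_def)
    then have "e * norm y \<le> 1" using False by (simp add: power2_norm_eq_inner[symmetric] power2_eq_square)
    then show ?thesis using assms by (simp add: field_simps)
  qed (use assms in simp)
qed

text \<open>The polar body is a finite intersection of half-planes. A ball inside \<open>P\<close>
  makes it bounded, hence a polytope, and a ball around \<open>P\<close> gives a ball inside
  it.\<close>

lemma polar_in_polygons_o: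
  assumes P: "P \<in> polygons_o"
  shows "polar P \<in> polygons_o"
proof -
  obtain S where S: "finite S" "P = convex hull S" and int: "0 \<in> interior P"
    using P by (auto simp: polygons_o_def)
  have ph: "polyhedron (polar P)"
    unfolding S(2) polar_convex_hull using S(1) by (intro polyhedron_Inter) (auto intro: polyhedron_halfspace_le)
  obtain e where e: "e > 0" "cball 0 e \<subseteq> P" using int by (meson mem_interior_cball)
  have "bounded (polar P)" by (rule bounded_subset[OF bounded_cball polar_subset_cball[OF e(2,1)]])
  with ph have "polytope (polar P)" by (simp add: polytope_eq_bounded_polyhedron)
  then obtain T where "finite T" "polar P = convex hull T" by (auto simp: polytope_def)
  moreover have "0 \<in> interior (polar P)"
  proof -
    obtain R where R: "R > 0" "\<And>x. x \<in> P \<Longrightarrow> norm x \<le> R"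
      using compact_imp_bounded[OF polygons_o_props(1)[OF P]] unfolding bounded_pos by blast
    have "cball 0 (1 / R) \<subseteq> polar P"
    proof
      fix y :: R2 assume "y \<in> cball 0 (1 / R)"
      then have "norm y * R \<le> 1" using R by (simp add: field_simps)
      moreover have "y \<bullet> x \<le> norm y * R" if "x \<in> P" for x
        using norm_cauchy_schwarz[of y x] mult_left_mono[OF R(2)[OF that] norm_ge_zero[of y]] by linarith
      ultimately show "y \<in> polar P" by (force simp: polar_def)
    qed
    then show ?thesis using R by (auto simp: mem_interior_cball intro!: exI[of _ "1 / R"])
  qed
  ultimately show ?thesis by (auto simp: polygons_o_def)
qed

text \<open>A point outside \<open>P\<close> is separated from \<open>P\<close> by \<open>a\<close>
  and \<open>b\<close>. As the origin lies in \<open>P\<close>, \<open>b\<close> is negative, and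
  \<open>a\<close> divided by \<open>b\<close> is a point of the polar body that excludes the given
  point.\<close>

lemma polar_polar:
  assumes P: "P \<in> polygons_o"
  shows "polar (polar P) = P"
proof (intro equalityI subsetI)
  fix z assume z: "z \<in> polar (polar P)"
  note props = polygons_o_props[OF P]
  show "z \<in> P"
  proof (rule ccontr)
    assume "z \<notin> P"
    then obtain a b where ab: "a \<bullet> z < b" "\<And>x. x \<in> P \<Longrightarrow> a \<bullet> x > b"
      using separating_hyperplane_closed_point[OF props(2) compact_imp_closed[OF props(1)]] by metis
    have b: "b < 0" using ab(2)[OF props(4)] by simp
    have "(1 / b) *\<^sub>R a \<in> polar P"
      unfolding polar_def using b less_imp_le[OF ab(2)] by (auto simp: divide_le_eq)
    then have "z \<bullet> ((1 / b) *\<^sub>R a) \<le> 1" using z unfolding polar_def[of "polar P"] by blast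
    then have "a \<bullet> z \<ge> b" using b by (simp add: divide_le_eq inner_commute)
    then show False using ab(1) by simp
  qed
qed (auto simp: polar_def inner_commute)

lemma polar_Un: "polar (K \<union> L) = polar K \<inter> polar L"
  by (auto simp: polar_def)

text \<open>If \<open>y\<close> exceeds 1 at \<open>u\<close> in \<open>K\<close> and at
  \<open>v\<close> in \<open>L\<close>, it does so on the whole segment between them. By convexity
  and connectedness this segment meets \<open>K \<inter> L\<close>.\<close>

lemma polar_Int:
  assumes "closed K" "closed L" "convex (K \<union> L)"
  shows "polar (K \<inter> L) = polar K \<union> polar L"
proof (intro equalityI subsetI)
  fix y assume y: "y \<in> polar (K \<inter> L)"
  show "y \<in> polar K \<union> polar L"
  proof (rule ccontr)
    assume "y \<notin> polar K \<union> polar L"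
    then obtain u v where u: "u \<in> K" "y \<bullet> u > 1" and v: "v \<in> L" "y \<bullet> v > 1"
      by (auto simp: polar_def not_le)
    have "closed_segment u v \<subseteq> K \<union> L"
      using u v assms(3) by (intro closed_segment_subset) auto
    moreover have "connected (closed_segment u v)" by simp
    ultimately have "K \<inter> L \<inter> closed_segment u v \<noteq> {}"
      using u v assms(1,2) connected_closedD[of "closed_segment u v" K L] by fastforce
    then obtain z where z: "z \<in> K \<inter> L" "z \<in> closed_segment u v" by blast
    have "closed_segment u v \<subseteq> {x. y \<bullet> x > 1}"
      using u v by (intro closed_segment_subset convex_halfspace_gt) auto
    then show False using z y by (force simp: polar_def)
  qed
qed (auto simp: polar_def)

text \<open>\<open>B\<close> is the inverse transpose of \<open>A\<close>; dividing by the
  determinant is the same as multiplying by it, since it is 1 or -1.\<close>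

lemma polar_linear_image:
  assumes "A \<in> VL2"
  defines "B \<equiv> mat2 (det A * A $ 2 $ 2) (- det A * A $ 2 $ 1) (- det A * A $ 1 $ 2) (det A * A $ 1 $ 1)"
  shows "polar ((*v) A ` P) = (*v) B ` polar P" "B \<in> VL2" "det B = det A"
proof -
  have D: "det A * det A = 1" using assms by (auto simp: VL2_def)
  have "det B = det A * det A * det A" by (simp add: B_def det_2 algebra_simps)
  then show "det B = det A" using D by simp
  then show "B \<in> VL2" using assms(1) by (simp add: VL2_def)
  have dual: "(B *v z) \<bullet> (A *v x) = z \<bullet> x" for x z
  proof -
    have "(B *v z) \<bullet> (A *v x) = (det A * det A) * (z \<bullet> x)"
      by (simp add: B_def inner_R2 mult_R2_nth det_2 algebra_simps)
    then show ?thesis using D by simp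
  qed
  have inv: "B *v (transpose A *v y) = y" for y
  proof -
    have "B *v (transpose A *v y) = (det A * det A) *\<^sub>R y"
      by (simp add: B_def R2_eq_iff mult_R2_nth transpose_def det_2 algebra_simps)
    then show ?thesis using D by simp
  qed
  show "polar ((*v) A ` P) = (*v) B ` polar P"
  proof (intro equalityI subsetI)
    fix y assume y: "y \<in> polar ((*v) A ` P)"
    have "(transpose A *v y) \<bullet> x = y \<bullet> (A *v x)" for x by (simp add: dot_lmul_matrix)
    then have "transpose A *v y \<in> polar P" using y by (auto simp: polar_def)
    then show "y \<in> (*v) B ` polar P" using inv[of y] by (metis imageI)
  qed (auto simp: polar_def dual)
qed

section \<open>Continuity of the polar body in the Hausdorff metric\<close>

text \<open>Closeness is expressed by mutual inclusion up to a dilation, because polarity turns such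
  inclusions into inclusions of the same kind. A dilation by \<open>1 + n\<close> moves points of
  norm at most \<open>R\<close> by at most \<open>n * R\<close>.\<close>

lemma hausdorff_dist_le:
  assumes K: "K \<in> polygons_o" and L: "L \<in> polygons_o" and n: "n \<ge> 0"
    and KL: "K \<subseteq> (\<lambda>x. (1 + n) *\<^sub>R x) ` L" "L \<subseteq> (\<lambda>x. (1 + n) *\<^sub>R x) ` K"
    and R: "K \<subseteq> cball 0 R" "L \<subseteq> cball 0 R"
  shows "hausdorff_dist K L \<le> n * R"
proof -
  have *: "(SUP x\<in>K. setdist {x} L) \<le> n * R"
    if sub: "K \<noteq> {}" "K \<subseteq> (\<lambda>x. (1 + n) *\<^sub>R x) ` L" "L \<subseteq> cball 0 R" for K L :: "R2 set"
  proof (rule cSUP_least)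
    fix x assume "x \<in> K"
    then obtain z where z: "z \<in> L" "x = (1 + n) *\<^sub>R z" using sub(2) by blast
    have "setdist {x} L \<le> dist x z" using z by (intro setdist_le_dist) auto
    also have "\<dots> = n * norm z" using z n by (simp add: dist_norm algebra_simps)
    also have "\<dots> \<le> n * R" using z sub(3) n by (intro mult_left_mono) auto
    finally show "setdist {x} L \<le> n * R" .
  qed fact
  show ?thesis
    unfolding hausdorff_dist_def
    using *[of K L] *[of L K] polygons_o_props(4)[OF K] polygons_o_props(4)[OF L] KL R by auto
qed

lemma polar_scale_subset:
  assumes "P \<subseteq> (\<lambda>x. (1 + n) *\<^sub>R x) ` Q" "n \<ge> 0"
  shows "polar Q \<subseteq> (\<lambda>x. (1 + n) *\<^sub>R x) ` polar P"
proof
  fix y assume y: "y \<in> polar Q"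
  have "(1 / (1 + n)) *\<^sub>R y \<in> polar P"
    unfolding polar_def using assms y by (force simp: polar_def)
  moreover have "y = (1 + n) *\<^sub>R ((1 / (1 + n)) *\<^sub>R y)" using assms(2) by simp
  ultimately show "y \<in> (\<lambda>x. (1 + n) *\<^sub>R x) ` polar P" by blast
qed

text \<open>Moving the upper vertex horizontally changes the quadrilateral by at most a dilation,
  since the horizontal diagonal is fixed and contains the origin in its interior.\<close>
lemma quad_dilation:
  assumes pos: "a > 0" "b > 0" "t > 0" "s > 0" and n: "n \<ge> 0" "\<bar>c - c'\<bar> * t \<le> n * min a b"
  shows "quad a b c t d s \<subseteq> (\<lambda>x. (1 + n) *\<^sub>R x) ` quad a b c' t d s"
proof -
  let ?Q = "quad a b c' t d s"
  have cv: "convex ?Q" by (simp add: quad_def)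
  have Q0: "0 \<in> ?Q" using polygons_o_props(4)[OF quad_in_polygons_o[OF pos]] .
  have vert: "pt b 0 \<in> ?Q" "pt (- a) 0 \<in> ?Q" "pt (c' * t) t \<in> ?Q" "pt (d * s) (- s) \<in> ?Q"
    by (auto simp: quad_def hull_inc)
  have scaled: "x \<in> (\<lambda>x. (1 + n) *\<^sub>R x) ` ?Q" if "(1 / (1 + n)) *\<^sub>R x \<in> ?Q" for x
    using that n(1) by (intro image_eqI[of _ _ "(1 / (1 + n)) *\<^sub>R x"]) auto
  have self: "x \<in> (\<lambda>x. (1 + n) *\<^sub>R x) ` ?Q" if "x \<in> ?Q" for x
  proof (rule scaled)
    have "(1 / (1 + n)) *\<^sub>R x + (n / (1 + n)) *\<^sub>R 0 \<in> ?Q"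
      using n(1) by (intro convexD[OF cv that Q0]) (auto simp: add_divide_distrib[symmetric])
    then show "(1 / (1 + n)) *\<^sub>R x \<in> ?Q" by simp
  qed
  have "pt (c * t) t \<in> (\<lambda>x. (1 + n) *\<^sub>R x) ` ?Q"
  proof (cases "n = 0")
    case True
    then have "c = c'" using n pos by (simp add: mult_le_0_iff)
    then show ?thesis using self vert by simp
  next
    case False
    then have n0: "n > 0" using n by simp
    \<comment> \<open>The moved vertex is the old one plus \<open>n *\<^sub>R pt h 0\<close> with
      \<open>pt h 0\<close> on the diagonal; divided by \<open>1 + n\<close> it is a convex
      combination of two points of \<open>?Q\<close>.\<close>
    define h where "h = (c - c') * t / n"
    have "\<bar>h\<bar> * n = \<bar>c - c'\<bar> * t" using n0 pos by (simp add: h_def abs_mult)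
    also have "\<dots> \<le> min a b * n" using n(2) by (simp only: mult.commute)
    finally have "\<bar>h\<bar> \<le> min a b" using n0 by (rule mult_right_le_imp_le)
    then have h: "- a \<le> h" "h \<le> b" by auto
    have "pt h 0 \<in> closed_segment (pt (- a) 0) (pt b 0)"
      unfolding in_segment
    proof (intro exI conjI)
      define u where "u = (h + a) / (a + b)"
      show "0 \<le> u" "u \<le> 1" using h pos by (auto simp: u_def)
      have "u * (a + b) = h + a" using pos by (simp add: u_def)
      then show "pt h 0 = (1 - u) *\<^sub>R pt (- a) 0 + u *\<^sub>R pt b 0"
        by (simp add: R2_eq_iff algebra_simps)
    qed
    then have hQ: "pt h 0 \<in> ?Q"
      using closed_segment_subset[OF vert(2,1) cv] by blast
    show ?thesis
    proof (rule scaled)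
      have "(1 / (1 + n)) *\<^sub>R pt (c' * t) t + (n / (1 + n)) *\<^sub>R pt h 0 \<in> ?Q"
        using n(1) by (intro convexD[OF cv vert(3) hQ]) (auto simp: add_divide_distrib[symmetric])
      moreover have "pt (c' * t) t + n *\<^sub>R pt h 0 = pt (c * t) t"
      proof -
        have "n * h = (c - c') * t" using n0 by (simp add: h_def)
        then show ?thesis by (simp add: R2_eq_iff left_diff_distrib)
      qed
      then have "(1 / (1 + n)) *\<^sub>R pt (c * t) t = (1 / (1 + n)) *\<^sub>R pt (c' * t) t + (n / (1 + n)) *\<^sub>R pt h 0"
        by (metis (no_types) scaleR_add_right scaleR_scaleR times_divide_eq_left mult_1)
      ultimately show "(1 / (1 + n)) *\<^sub>R pt (c * t) t \<in> ?Q" by simp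
    qed
  qed
  moreover have "convex ((\<lambda>x. (1 + n) *\<^sub>R x) ` ?Q)" using cv by (rule convex_scaling)
  ultimately show ?thesis
    unfolding quad_def[of a b c] using self vert by (intro hull_minimal) auto
qed

text \<open>The map is even continuous: a small change of \<open>c\<close> stays within a small
  dilation of the quadrilateral, hence of its polar body.\<close>

lemma polar_quad_measurable:
  assumes pos: "a > 0" "b > 0" "t > 0" "s > 0"
  shows "(\<lambda>c. polar (quad a b c t d s)) \<in> measurable borel polygons_borel"
  unfolding polygons_borel_def
proof (rule measurable_measure_of)
  show "{U. hausdorff_open U} \<subseteq> Pow polygons_o" by (auto simp: hausdorff_open_def)
  have in_o: "polar (quad a b c t d s) \<in> polygons_o" for c
    by (intro polar_in_polygons_o quad_in_polygons_o pos)
  then show "(\<lambda>c. polar (quad a b c t d s)) \<in> space borel \<rightarrow> polygons_o" by simp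
  fix U assume "U \<in> {U. hausdorff_open U}"
  then have U: "hausdorff_open U" by simp
  have "open {c. polar (quad a b c t d s) \<in> U}"
    unfolding open_dist
  proof (intro ballI)
    fix c assume "c \<in> {c. polar (quad a b c t d s) \<in> U}"
    then obtain e where e: "e > 0"
      "\<And>Q. Q \<in> polygons_o \<Longrightarrow> hausdorff_dist (polar (quad a b c t d s)) Q < e \<Longrightarrow> Q \<in> U"
      using U unfolding hausdorff_open_def by blast
    obtain R where R: "R > 0" "polar (quad a b c t d s) \<subseteq> cball 0 R"
    proof -
      have "bounded (polar (quad a b c t d s))"
        using polygons_o_props(1)[OF in_o] by (rule compact_imp_bounded)
      then show thesis using that unfolding bounded_pos by (auto simp: subset_iff)
    qed
    \<comment> \<open>The bound 1 keeps the polar body of the moved quadrilateral within radius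
      \<open>2 * R\<close>; the other bound then makes the Hausdorff distance at most
      \<open>e / 2\<close>.\<close>
    define n where "n = min 1 (e / (4 * R))"
    have n: "n > 0" "n \<le> 1" "n * (2 * R) < e" 
    proof -
      show "n > 0" "n \<le> 1" using e R by (auto simp: n_def)
      have "n * (2 * R) \<le> e / (4 * R) * (2 * R)" using R by (intro mult_right_mono) (auto simp: n_def)
      then show "n * (2 * R) < e" using e R by simp
    qed
    show "\<exists>\<delta>>0. \<forall>c'. dist c' c < \<delta> \<longrightarrow> c' \<in> {c. polar (quad a b c t d s) \<in> U}"
    proof (intro exI conjI allI impI)
      show "n * min a b / t > 0" using n pos by simp
      fix c' assume "dist c' c < n * min a b / t"
      then have "\<bar>c' - c\<bar> * t \<le> n * min a b" using pos by (simp add: dist_real_def field_simps)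
      then have "quad a b c' t d s \<subseteq> (\<lambda>x. (1 + n) *\<^sub>R x) ` quad a b c t d s"
        "quad a b c t d s \<subseteq> (\<lambda>x. (1 + n) *\<^sub>R x) ` quad a b c' t d s"
        using n pos by (intro quad_dilation; simp add: abs_minus_commute)+
      then have sub: "polar (quad a b c t d s) \<subseteq> (\<lambda>x. (1 + n) *\<^sub>R x) ` polar (quad a b c' t d s)"
        "polar (quad a b c' t d s) \<subseteq> (\<lambda>x. (1 + n) *\<^sub>R x) ` polar (quad a b c t d s)"
        using n by (intro polar_scale_subset; simp)+
      have "polar (quad a b c' t d s) \<subseteq> cball 0 (2 * R)"
      proof
        fix y assume "y \<in> polar (quad a b c' t d s)"
        then obtain x where x: "x \<in> cball 0 R" "y = (1 + n) *\<^sub>R x" using sub(2) R(2) by blast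
        then have "norm y \<le> 2 * R" using n R by (auto intro!: mult_mono)
        then show "y \<in> cball 0 (2 * R)" by simp
      qed
      moreover have "polar (quad a b c t d s) \<subseteq> cball 0 (2 * R)" using R by force
      ultimately have "hausdorff_dist (polar (quad a b c t d s)) (polar (quad a b c' t d s)) \<le> n * (2 * R)"
        using hausdorff_dist_le[OF in_o in_o _ sub] n by simp
      then show "c' \<in> {c. polar (quad a b c t d s) \<in> U}" using e(2)[OF in_o] n(3) by simp
    qed
  qed
  then show "(\<lambda>c. polar (quad a b c t d s)) -` U \<inter> space borel \<in> sets borel"
    by (simp add: vimage_def)
qed

section \<open>From measurability to regularity, and transfer by polarity\<close>

text \<open>The sets where \<open>\<bar>f x\<bar> \<le> n\<close> exhaust the interval, so they
  cannot all be null sets.\<close>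

lemma measurable_bounded_on_positive_set:
  fixes f :: "real \<Rightarrow> real"
  assumes f: "f \<in> borel_measurable borel"
  shows "\<exists>A\<in>sets lebesgue. A \<subseteq> {-1..1} \<and> emeasure lebesgue A > 0 \<and> bounded (f ` A)"
proof -
  define A where "A n = {x. \<bar>f x\<bar> \<le> real n} \<inter> {-1..1}" for n
  have A_borel: "A n \<in> sets borel" for n unfolding A_def using f by measurable
  have A: "A n \<in> sets lebesgue" for n using A_borel[of n] by simp
  have un: "(\<Union>n. A n) = {-1..1}" using real_arch_simple by (force simp: A_def)
  have "\<exists>n. emeasure lebesgue (A n) > 0"
  proof (rule ccontr)
    assume "\<not> ?thesis"
    then have "A n \<in> null_sets lebesgue" for n using A[of n] by (auto simp: null_sets_def not_less)
    then have "(\<Union>n. A n) \<in> null_sets lebesgue" by (rule null_sets_UN)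
    then have "emeasure lebesgue {-1..1::real} = 0" unfolding un by (simp add: null_sets_def)
    then show False by simp
  qed
  then obtain n where n: "emeasure lebesgue (A n) > 0" ..
  moreover have "bounded (f ` A n)" unfolding bounded_iff by (intro exI[of _ "real n"]) (auto simp: A_def)
  moreover have "A n \<subseteq> {-1..1}" by (auto simp: A_def)
  ultimately show ?thesis using A by blast
qed

lemma rot90_nth [simp]: "rot90 x $ 1 = - (x $ 2)" "rot90 x $ 2 = x $ 1"
  by (auto simp: rot90_def)

theorem theorem3p9:
  fixes mu :: "R2 set \<Rightarrow> R2"
  assumes meas: "mu \<in> measurable polygons_borel borel"
    and val: "is_valuation_on polygons_o mu"
    and cov: "\<And>A P. A \<in> VL2 \<Longrightarrow> P \<in> polygons_o \<Longrightarrow>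
                 mu ((\<lambda>x. A *v x) ` P) = det A *\<^sub>R (A *v mu P)"
  shows "\<exists>k::real. \<forall>P\<in>polygons_o. mu P = k *\<^sub>R rot90 (moment (polar P))"
proof -
  \<comment> \<open>\<open>- rot90\<close> is the inverse of \<open>rot90\<close>, since two quarter
    turns give \<open>-1\<close>.\<close>
  define nu where "nu P = - rot90 (mu (polar P))" for P
  have "regular_covariant_valuation nu"
  proof
    show "is_valuation_on polygons_o nu"
      unfolding is_valuation_on_def
    proof (intro allI impI)
      fix K L :: "R2 set"
      assume KL: "K \<in> polygons_o \<and> L \<in> polygons_o \<and> K \<union> L \<in> polygons_o \<and> K \<inter> L \<in> polygons_o"
      have eq: "polar (K \<inter> L) = polar K \<union> polar L"
        using KL by (intro polar_Int) (auto intro: compact_imp_closed polygons_o_props)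
      have "polar K \<in> polygons_o" "polar L \<in> polygons_o" "polar K \<union> polar L \<in> polygons_o"
        "polar K \<inter> polar L \<in> polygons_o"
        using KL polar_in_polygons_o unfolding eq[symmetric] polar_Un[symmetric] by auto
      then have "mu (polar K \<union> polar L) + mu (polar K \<inter> polar L) = mu (polar K) + mu (polar L)"
        using val unfolding is_valuation_on_def by blast
      then have "mu (polar (K \<inter> L)) + mu (polar (K \<union> L)) = mu (polar K) + mu (polar L)"
        by (simp only: eq polar_Un)
      then show "nu (K \<union> L) + nu (K \<inter> L) = nu K + nu L"
        by (simp add: nu_def R2_eq_iff)
    qed
    show "nu ((*v) A ` P) = A *v nu P" if A: "A \<in> VL2" and P: "P \<in> polygons_o" for A P
    proof -
      have D: "det A * det A = 1" using A by (auto simp: VL2_def)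
      define B where "B = mat2 (det A * A $ 2 $ 2) (- det A * A $ 2 $ 1) (- det A * A $ 1 $ 2) (det A * A $ 1 $ 1)"
      have "mu (polar ((*v) A ` P)) = det A *\<^sub>R (B *v mu (polar P))"
        using polar_linear_image[OF A] cov[of B "polar P"] polar_in_polygons_o[OF P] by (simp add: B_def)
      \<comment> \<open>Conjugation by the quarter turn takes the inverse transpose \<open>B\<close>
        to \<open>det A\<close> times \<open>A\<close>. This second factor \<open>det A\<close>
        cancels the one from signum-covariance.\<close>
      then have "nu ((*v) A ` P) = (det A * det A) *\<^sub>R (A *v nu P)"
        by (simp add: nu_def R2_eq_iff mult_R2_nth B_def algebra_simps)
      then show ?thesis using D by simp
    qed
    fix a b t s :: real assume pos: "a > 0" "b > 0" "t > 0" "s > 0"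
    have "(\<lambda>c. mu (polar (quad a b c t 0 s))) \<in> borel_measurable borel"
      using measurable_compose[OF polar_quad_measurable[OF pos] meas] .
    moreover have "(\<lambda>x::R2. x $ 2) \<in> borel_measurable borel"
      by (intro borel_measurable_continuous_onI continuous_intros)
    ultimately have "(\<lambda>c. mu (polar (quad a b c t 0 s)) $ 2) \<in> borel_measurable borel"
      by (rule measurable_compose)
    then have "(\<lambda>c. nu (quad a b c t 0 s) $ 1) \<in> borel_measurable borel"
      by (simp add: nu_def)
    then show "\<exists>A\<in>sets lebesgue. A \<subseteq> {-1..1} \<and> emeasure lebesgue A > 0 \<and>
        bounded ((\<lambda>c. nu (quad a b c t 0 s) $ 1) ` A)"
      by (rule measurable_bounded_on_positive_set)
  qed
  then obtain k where k: "\<And>P. P \<in> polygons_o \<Longrightarrow> nu P = k *\<^sub>R moment P"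
    using regular_covariant_valuation_eq_moment by blast
  have "mu P = k *\<^sub>R rot90 (moment (polar P))" if P: "P \<in> polygons_o" for P
  proof -
    have "mu P = rot90 (nu (polar P))"
      by (simp add: nu_def polar_polar[OF P] R2_eq_iff)
    also have "\<dots> = k *\<^sub>R rot90 (moment (polar P))"
      by (simp add: k[OF polar_in_polygons_o[OF P]] R2_eq_iff)
    finally show ?thesis .
  qed
  then show ?thesis by blast
qed

end
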